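(* Let $\boldsymbol{\sigma}=(\sigma_n)_{n\in\mathbb N}$, $\sigma_n\colon A_{n+1}^+\to A_n^+$, be a primitive directive sequence, and let $\mathsf V$ be a pseudovariety of semigroups containing $\mathsf{LSl}$. The following statements are equivalent: (i) $\boldsymbol{\sigma}$ has a proper contraction; (ii) $\mathrm{Im}_{\mathsf V}(\boldsymbol{\sigma}^{(k)})$ is a group for every $k\ge 0$; (iii) $\mathrm{Im}_{\mathsf V}^{\infty}(\boldsymbol{\sigma})$ is a group.
   Context: For a finite alphabet $A$, $A^+$ is the free semigroup on $A$ and $|w|$ is the length of $w$. A directive sequence is a sequence $\boldsymbol{\sigma}=(\sigma_n)_{n\in\mathbb N}$ of homomorphisms $\sigma_n\colon A_{n+1}^+\to A_n^+$, each $A_n$ a finite nonempty alphabet. Put $\sigma_{n,m}=\sigma_n\circ\cdots\circ\sigma_{m-1}$ for $n\le m$ (identity if $n=m$) and $\boldsymbol{\sigma}^{(k)}=(\sigma_{n+k})_{n\in\mathbb N}$. A homomorphism $\varphi\colon A^+\to B^+$ is positive if for every $a\in A$ one has $|\varphi(a)|\ge 2$ and every letter of $B$ occurs in $\varphi(a)$; $\boldsymbol{\sigma}$ is primitive if for every $n$ there is $m>n$ with $\sigma_{n,m}$ positive. A homomorphism $\varphi\colon A^+\to B^+$ is left proper (resp. right proper) if there is $b\in B$ such that $\varphi(a)$ starts (resp. ends) with $b$ for every $a\in A$, and proper if it is both; a directive sequence is proper if all its terms are. A contraction of $\boldsymbol{\sigma}$ is a sequence $(\sigma_{n_k,n_{k+1}})_{k\in\mathbb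 N}$ with $0=n_0<n_1<n_2<\cdots$. A pseudovariety of semigroups is a class of finite semigroups closed under subsemigroups, homomorphic images and finite direct products. $\mathsf{LSl}$ is the pseudovariety of finite semigroups $S$ such that $eSe$ is a semilattice (commutative with all elements idempotent) for every idempotent $e\in S$. $\overline{\Omega}_A\mathsf V$ is the free pro-$\mathsf V$ semigroup on $A$ (pro-$\mathsf V$: inverse limit of members of $\mathsf V$ with discrete topologies); for the $\mathsf V$ considered it contains $A^+$ as a dense subsemigroup, and each homomorphism $\varphi\colon A^+\to B^+$ extends uniquely to a continuous homomorphism $\varphi^{\mathsf V}\colon\overline{\Omega}_A\mathsf V\to\overline{\Omega}_B\mathsf V$. Define $\mathrm{Im}_{\mathsf V}(\boldsymbol{\sigma})=\bigcap_{n\in\mathbb N}\mathrm{Im}(\sigma_{0,n}^{\mathsf V})$, a closed subsemigroup of $\overline{\Omega}_{A_0}\mathsf V$. For $m\ge n$, $\sigma_{n,m}^{\mathsf V}$ maps $\mathrm{Im}_{\mathsf V}(\boldsymbol{\sigma}^{(m)})$ onto $\mathrm{Im}_{\mathsf V}(\boldsymbol{\sigma}^{(n)})$; $\mathrm{Im}_{\mathsf V}^{\infty}(\boldsymbol{\sigma})$ is the inverse limit of the resulting inverse system of profinite semigroups $(\mathrm{Im}_{\mathsf V}(\boldsymbol{\sigma}^{(n)}))_{n\in\mathbb N}$. *)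

theory Defs
  imports "HOL-Algebra.Group" "HOL-Analysis.Abstract_Topological_Spaces"
begin

section \<open>Semigroups and topological semigroups\<close>

text \<open>HOL-Algebra has no structure without a distinguished identity. As usual there, only the
  values of the operation on the carrier are meaningful.\<close>

record 'a sgrp = "'a partial_object" +
  mul :: "'a \<Rightarrow> 'a \<Rightarrow> 'a"

record 'a top_sgrp = "'a sgrp" +
  topo :: "'a topology"

definition is_semigroup :: "('a, 'c) sgrp_scheme \<Rightarrow> bool" where
  "is_semigroup S \<longleftrightarrow> carrier S \<noteq> {}
     \<and> (\<forall>x\<in>carrier S. \<forall>y\<in>carrier S. mul S x y \<in> carrier S)
     \<and> (\<forall>x\<in>carrier S. \<forall>y\<in>carrier S. \<forall>z\<in>carrier S.
           mul S (mul S x y) z = mul S x (mul S y z))"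

definition is_group :: "('a, 'c) sgrp_scheme \<Rightarrow> bool" where
  "is_group S \<longleftrightarrow> (\<exists>e. group \<lparr>carrier = carrier S, monoid.mult = mul S, one = e\<rparr>)"

definition sg_hom :: "('a, 'c) sgrp_scheme \<Rightarrow> ('b, 'd) sgrp_scheme \<Rightarrow> ('a \<Rightarrow> 'b) set" where
  "sg_hom S T = {h. h \<in> carrier S \<rightarrow> carrier T
     \<and> (\<forall>x\<in>carrier S. \<forall>y\<in>carrier S. h (mul S x y) = mul T (h x) (h y))}"

definition sg_iso :: "('a, 'c) sgrp_scheme \<Rightarrow> ('b, 'd) sgrp_scheme \<Rightarrow> bool" where
  "sg_iso S T \<longleftrightarrow> (\<exists>h \<in> sg_hom S T. bij_betw h (carrier S) (carrier T))"

definition sg_product :: "'i set \<Rightarrow> ('i \<Rightarrow> 'a sgrp) \<Rightarrow> ('i \<Rightarrow> 'a) sgrp" where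
  "sg_product I S =
     \<lparr>carrier = (\<Pi>\<^sub>E i\<in>I. carrier (S i)), mul = (\<lambda>x y. \<lambda>i\<in>I. mul (S i) (x i) (y i))\<rparr>"

definition discrete_sg :: "'a sgrp \<Rightarrow> 'a top_sgrp" where
  "discrete_sg S = \<lparr>carrier = carrier S, mul = mul S, topo = discrete_topology (carrier S)\<rparr>"

definition top_subsg :: "'a top_sgrp \<Rightarrow> 'a set \<Rightarrow> 'a top_sgrp" where
  "top_subsg S X = \<lparr>carrier = X, mul = mul S, topo = subtopology (topo S) X\<rparr>"

text \<open>The limit of a system of topological semigroups \<open>X i\<close> (\<open>i \<in> I\<close>), where \<open>H i j\<close> is the set
  of connecting homomorphisms from \<open>X j\<close> to \<open>X i\<close>; for an inverse system over a directed set,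
  \<open>H i j\<close> is a singleton if \<open>i \<le> j\<close> and empty otherwise.\<close>

definition inv_limit ::
  "'i set \<Rightarrow> ('i \<Rightarrow> 'x top_sgrp) \<Rightarrow> ('i \<Rightarrow> 'i \<Rightarrow> ('x \<Rightarrow> 'x) set) \<Rightarrow> ('i \<Rightarrow> 'x) top_sgrp" where
  "inv_limit I X H =
    (let C = {x \<in> (\<Pi>\<^sub>E i\<in>I. carrier (X i)). \<forall>i\<in>I. \<forall>j\<in>I. \<forall>h\<in>H i j. h (x j) = x i}
     in \<lparr>carrier = C,
         mul = (\<lambda>x y. \<lambda>i\<in>I. mul (X i) (x i) (y i)),
         topo = subtopology (product_topology (\<lambda>i. topo (X i)) I) C\<rparr>)"

section \<open>Pseudovarieties\<close>

text \<open>Every finite semigroup is isomorphic to one whose carrier is a set of natural numbers, so a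
  class of finite semigroups closed under isomorphism is represented by the set of its members
  with such a carrier. The product of the empty family puts the trivial semigroups into every
  pseudovariety.\<close>

definition pseudovariety :: "nat sgrp set \<Rightarrow> bool" where
  "pseudovariety V \<longleftrightarrow>
     (\<forall>S\<in>V. is_semigroup S \<and> finite (carrier S))
   \<and> (\<forall>S\<in>V. \<forall>T. is_semigroup T \<and> carrier T \<subseteq> carrier S
         \<and> (\<forall>x\<in>carrier T. \<forall>y\<in>carrier T. mul T x y = mul S x y) \<longrightarrow> T \<in> V)
   \<and> (\<forall>S\<in>V. \<forall>T h. is_semigroup T \<and> h \<in> sg_hom S T \<and> h ` carrier S = carrier T \<longrightarrow> T \<in> V)
   \<and> (\<forall>(n::nat) F T. (\<forall>i<n. F i \<in> V) \<and> is_semigroup T \<and> sg_iso (sg_product {..<n} F) T \<longrightarrow> T \<in> V)"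

definition LSl :: "nat sgrp set" where
  "LSl = {S. is_semigroup S \<and> finite (carrier S)
     \<and> (\<forall>e\<in>carrier S. mul S e e = e \<longrightarrow>
          (let L = {mul S (mul S e s) e | s. s \<in> carrier S}
           in (\<forall>x\<in>L. mul S x x = x) \<and> (\<forall>x\<in>L. \<forall>y\<in>L. mul S x y = mul S y x)))}"

section \<open>Free semigroups and free profinite semigroups\<close>

definition free_sg :: "'a set \<Rightarrow> 'a list sgrp" where
  "free_sg A = \<lparr>carrier = lists A - {[]}, mul = (@)\<rparr>"

text \<open>The free pro-\<open>V\<close> semigroup on \<open>A\<close>, as the inverse limit of the \<open>A\<close>-generated members of \<open>V\<close>.
  An \<open>A\<close>-generated member is a pair \<open>(S, p)\<close> with \<open>p\<close> a homomorphism from \<open>A\<^sup>+\<close> onto \<open>S\<close>, and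
  there is at most one homomorphism between two such pairs that respects the generators.\<close>

type_synonym 'a quot = "nat sgrp \<times> ('a list \<Rightarrow> nat)"

definition quots :: "nat sgrp set \<Rightarrow> 'a set \<Rightarrow> 'a quot set" where
  "quots V A =
     {(S, p). S \<in> V \<and> p \<in> sg_hom (free_sg A) S \<and> p ` carrier (free_sg A) = carrier S}"

definition quot_maps :: "'a set \<Rightarrow> 'a quot \<Rightarrow> 'a quot \<Rightarrow> (nat \<Rightarrow> nat) set" where
  "quot_maps A i j =
     {h \<in> sg_hom (fst j) (fst i). \<forall>w\<in>carrier (free_sg A). h (snd j w) = snd i w}"

definition free_pro :: "nat sgrp set \<Rightarrow> 'a set \<Rightarrow> ('a quot \<Rightarrow> nat) top_sgrp" where
  "free_pro V A = inv_limit (quots V A) (\<lambda>i. discrete_sg (fst i)) (quot_maps A)"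

definition word_emb :: "nat sgrp set \<Rightarrow> 'a set \<Rightarrow> 'a list \<Rightarrow> ('a quot \<Rightarrow> nat)" where
  "word_emb V A w = (\<lambda>i\<in>quots V A. snd i w)"

definition is_pro_ext :: "nat sgrp set \<Rightarrow> 'a set \<Rightarrow> 'a set \<Rightarrow> ('a list \<Rightarrow> 'a list)
    \<Rightarrow> (('a quot \<Rightarrow> nat) \<Rightarrow> ('a quot \<Rightarrow> nat)) \<Rightarrow> bool" where
  "is_pro_ext V A B f F \<longleftrightarrow>
     F \<in> extensional (carrier (free_pro V A))
   \<and> F \<in> sg_hom (free_pro V A) (free_pro V B)
   \<and> continuous_map (topo (free_pro V A)) (topo (free_pro V B)) F
   \<and> (\<forall>w\<in>carrier (free_sg A). F (word_emb V A w) = word_emb V B (f w))"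

definition pro_ext :: "nat sgrp set \<Rightarrow> 'a set \<Rightarrow> 'a set \<Rightarrow> ('a list \<Rightarrow> 'a list)
    \<Rightarrow> ('a quot \<Rightarrow> nat) \<Rightarrow> ('a quot \<Rightarrow> nat)" where
  "pro_ext V A B f = (THE F. is_pro_ext V A B f F)"

section \<open>Directive sequences\<close>

definition directive_seq :: "(nat \<Rightarrow> 'a set) \<Rightarrow> (nat \<Rightarrow> 'a list \<Rightarrow> 'a list) \<Rightarrow> bool" where
  "directive_seq A \<sigma> \<longleftrightarrow>
     (\<forall>n. finite (A n) \<and> A n \<noteq> {} \<and> \<sigma> n \<in> sg_hom (free_sg (A (Suc n))) (free_sg (A n)))"

text \<open>\<open>\<sigma> n \<circ> \<dots> \<circ> \<sigma> (m - 1)\<close>, for \<open>n \<le> m\<close>.\<close>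

definition sig_comp :: "(nat \<Rightarrow> 'a list \<Rightarrow> 'a list) \<Rightarrow> nat \<Rightarrow> nat \<Rightarrow> 'a list \<Rightarrow> 'a list" where
  "sig_comp \<sigma> n m = foldr (\<circ>) (map \<sigma> [n..<m]) id"

definition seq_shift :: "nat \<Rightarrow> (nat \<Rightarrow> 'b) \<Rightarrow> nat \<Rightarrow> 'b" where
  "seq_shift k s = (\<lambda>n. s (n + k))"

definition positive_hom :: "'a set \<Rightarrow> 'a set \<Rightarrow> ('a list \<Rightarrow> 'a list) \<Rightarrow> bool" where
  "positive_hom A B f \<longleftrightarrow> (\<forall>a\<in>A. length (f [a]) \<ge> 2 \<and> (\<forall>b\<in>B. b \<in> set (f [a])))"

definition primitive_seq :: "(nat \<Rightarrow> 'a set) \<Rightarrow> (nat \<Rightarrow> 'a list \<Rightarrow> 'a list) \<Rightarrow> bool" where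
  "primitive_seq A \<sigma> \<longleftrightarrow> (\<forall>n. \<exists>m>n. positive_hom (A m) (A n) (sig_comp \<sigma> n m))"

definition left_proper :: "'a set \<Rightarrow> 'a set \<Rightarrow> ('a list \<Rightarrow> 'a list) \<Rightarrow> bool" where
  "left_proper A B f \<longleftrightarrow> (\<exists>b\<in>B. \<forall>a\<in>A. hd (f [a]) = b)"

definition right_proper :: "'a set \<Rightarrow> 'a set \<Rightarrow> ('a list \<Rightarrow> 'a list) \<Rightarrow> bool" where
  "right_proper A B f \<longleftrightarrow> (\<exists>b\<in>B. \<forall>a\<in>A. last (f [a]) = b)"

definition proper_seq :: "(nat \<Rightarrow> 'a set) \<Rightarrow> (nat \<Rightarrow> 'a list \<Rightarrow> 'a list) \<Rightarrow> bool" where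
  "proper_seq A \<sigma> \<longleftrightarrow>
     (\<forall>n. left_proper (A (Suc n)) (A n) (\<sigma> n) \<and> right_proper (A (Suc n)) (A n) (\<sigma> n))"

definition has_proper_contraction ::
  "(nat \<Rightarrow> 'a set) \<Rightarrow> (nat \<Rightarrow> 'a list \<Rightarrow> 'a list) \<Rightarrow> bool" where
  "has_proper_contraction A \<sigma> \<longleftrightarrow>
     (\<exists>r. r 0 = 0 \<and> strict_mono r
        \<and> proper_seq (\<lambda>k. A (r k)) (\<lambda>k. sig_comp \<sigma> (r k) (r (Suc k))))"

section \<open>The profinite images of a directive sequence\<close>

definition pro_comp :: "nat sgrp set \<Rightarrow> (nat \<Rightarrow> 'a set) \<Rightarrow> (nat \<Rightarrow> 'a list \<Rightarrow> 'a list)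
    \<Rightarrow> nat \<Rightarrow> nat \<Rightarrow> ('a quot \<Rightarrow> nat) \<Rightarrow> ('a quot \<Rightarrow> nat)" where
  "pro_comp V A \<sigma> n m = pro_ext V (A m) (A n) (sig_comp \<sigma> n m)"

definition pro_Im :: "nat sgrp set \<Rightarrow> (nat \<Rightarrow> 'a set) \<Rightarrow> (nat \<Rightarrow> 'a list \<Rightarrow> 'a list)
    \<Rightarrow> ('a quot \<Rightarrow> nat) top_sgrp" where
  "pro_Im V A \<sigma> =
     top_subsg (free_pro V (A 0)) (\<Inter>n. pro_comp V A \<sigma> 0 n ` carrier (free_pro V (A n)))"

definition pro_Im_inf :: "nat sgrp set \<Rightarrow> (nat \<Rightarrow> 'a set) \<Rightarrow> (nat \<Rightarrow> 'a list \<Rightarrow> 'a list)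
    \<Rightarrow> (nat \<Rightarrow> 'a quot \<Rightarrow> nat) top_sgrp" where
  "pro_Im_inf V A \<sigma> =
     inv_limit UNIV (\<lambda>n. pro_Im V (seq_shift n A) (seq_shift n \<sigma>))
       (\<lambda>n m. if n \<le> m then {pro_comp V A \<sigma> n m} else {})"

section \<open>Existence and uniqueness of the continuous extension\<close>

lemma free_sg_closed:
  "u \<in> carrier (free_sg A) \<Longrightarrow> v \<in> carrier (free_sg A) \<Longrightarrow> u @ v \<in> carrier (free_sg A)"
  by (auto simp: free_sg_def)

lemma sg_hom_free:
  "p \<in> sg_hom (free_sg A) S \<longleftrightarrow> (\<forall>w\<in>carrier (free_sg A). p w \<in> carrier S)
    \<and> (\<forall>u\<in>carrier (free_sg A). \<forall>v\<in>carrier (free_sg A). p (u @ v) = mul S (p u) (p v))"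
  by (auto simp: sg_hom_def free_sg_def)

lemma free_pro_carrier:
  "x \<in> carrier (free_pro V A) \<longleftrightarrow> x \<in> (\<Pi>\<^sub>E i\<in>quots V A. carrier (fst i))
     \<and> (\<forall>i\<in>quots V A. \<forall>j\<in>quots V A. \<forall>h\<in>quot_maps A i j. h (x j) = x i)"
  by (simp add: free_pro_def inv_limit_def discrete_sg_def Let_def)

lemma free_pro_mul:
  "mul (free_pro V A) x y = (\<lambda>i\<in>quots V A. mul (fst i) (x i) (y i))"
  by (simp add: free_pro_def inv_limit_def discrete_sg_def Let_def)

lemma free_pro_topo:
  "topo (free_pro V A) = subtopology
     (product_topology (\<lambda>i. discrete_topology (carrier (fst i))) (quots V A)) (carrier (free_pro V A))"
  by (simp add: free_pro_def inv_limit_def discrete_sg_def Let_def)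

lemma free_pro_topspace: "topspace (topo (free_pro V A)) = carrier (free_pro V A)"
proof -
  have "carrier (free_pro V A) \<subseteq> (\<Pi>\<^sub>E i\<in>quots V A. carrier (fst i))"
    unfolding free_pro_carrier subset_iff by blast
  then show ?thesis unfolding free_pro_topo by (simp add: Int_absorb1)
qed

lemma quot_hom: "i \<in> quots V A \<Longrightarrow> snd i \<in> sg_hom (free_sg A) (fst i)"
  by (auto simp: quots_def)

lemma pv_sg: "pseudovariety V \<Longrightarrow> S \<in> V \<Longrightarrow> is_semigroup S"
  and pv_finite: "pseudovariety V \<Longrightarrow> S \<in> V \<Longrightarrow> finite (carrier S)"
  unfolding pseudovariety_def by blast+

lemma quot_mem: "i \<in> quots V A \<Longrightarrow> fst i \<in> V"
  by (auto simp: quots_def)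

lemma free_pro_at: "x \<in> carrier (free_pro V A) \<Longrightarrow> i \<in> quots V A \<Longrightarrow> x i \<in> carrier (fst i)"
  unfolding free_pro_carrier by (blast dest: PiE_mem)

lemma free_pro_compat: "x \<in> carrier (free_pro V A) \<Longrightarrow> i \<in> quots V A \<Longrightarrow> j \<in> quots V A
    \<Longrightarrow> h \<in> quot_maps A i j \<Longrightarrow> h (x j) = x i"
  unfolding free_pro_carrier by blast

lemma free_pro_mul_closed:
  assumes V: "pseudovariety V"
    and x: "x \<in> carrier (free_pro V A)" and y: "y \<in> carrier (free_pro V A)"
  shows "mul (free_pro V A) x y \<in> carrier (free_pro V A)"
proof -
  have sg: "is_semigroup (fst i)" if "i \<in> quots V A" for i
    using pv_sg[OF V quot_mem[OF that]] .
  have xi: "x i \<in> carrier (fst i)" "y i \<in> carrier (fst i)" if "i \<in> quots V A" for i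
    using x y that by (simp_all add: free_pro_at)
  have "h (mul (fst j) (x j) (y j)) = mul (fst i) (x i) (y i)"
    if "i \<in> quots V A" "j \<in> quots V A" and h: "h \<in> quot_maps A i j" for i j h
  proof -
    have "h (mul (fst j) (x j) (y j)) = mul (fst i) (h (x j)) (h (y j))"
      using h xi that by (auto simp: quot_maps_def sg_hom_def)
    moreover have "h (x j) = x i" "h (y j) = y i" using x y that by (simp_all add: free_pro_compat)
    ultimately show ?thesis by simp
  qed
  then have "\<forall>i\<in>quots V A. \<forall>j\<in>quots V A. \<forall>h\<in>quot_maps A i j.
      h (mul (fst j) (x j) (y j)) = mul (fst i) (x i) (y i)" by blast
  then show ?thesis using sg xi unfolding free_pro_carrier
    by (simp add: free_pro_mul is_semigroup_def)
qed

lemma word_emb_carrier: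
  assumes "w \<in> carrier (free_sg A)"
  shows "word_emb V A w \<in> carrier (free_pro V A)"
proof -
  have "snd i w \<in> carrier (fst i)" if "i \<in> quots V A" for i
    using quot_hom[OF that] assms by (simp add: sg_hom_free)
  then show ?thesis using assms unfolding free_pro_carrier
    by (simp add: word_emb_def quot_maps_def)
qed

lemma image_quot:
  assumes V: "pseudovariety V" and A: "A \<noteq> {}" and S: "S \<in> V" and p: "p \<in> sg_hom (free_sg A) S"
  shows "(\<lparr>carrier = p ` carrier (free_sg A), mul = mul S\<rparr>, p) \<in> quots V A"
proof -
  let ?T = "\<lparr>carrier = p ` carrier (free_sg A), mul = mul S\<rparr>"
  have sS: "is_semigroup S" using pv_sg[OF V S] .
  have ne: "carrier (free_sg A) \<noteq> {}"
  proof -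
    obtain a where "a \<in> A" using A by auto
    then have "[a] \<in> carrier (free_sg A)" by (auto simp: free_sg_def)
    then show ?thesis by auto
  qed
  have sub: "carrier ?T \<subseteq> carrier S" using p by (auto simp: sg_hom_free)
  have cl: "mul S x y \<in> carrier ?T" if "x \<in> carrier ?T" "y \<in> carrier ?T" for x y
  proof -
    obtain u v where "u \<in> carrier (free_sg A)" "v \<in> carrier (free_sg A)" "x = p u" "y = p v"
      using \<open>x \<in> carrier ?T\<close> \<open>y \<in> carrier ?T\<close> by auto
    then have "mul S x y = p (u @ v)" "u @ v \<in> carrier (free_sg A)"
      using p free_sg_closed by (auto simp: sg_hom_free)
    then show ?thesis by auto
  qed
  have sT: "is_semigroup ?T"
    unfolding is_semigroup_def
  proof (intro conjI ballI)
    show "carrier ?T \<noteq> {}" using ne by simp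
    show "mul ?T x y \<in> carrier ?T" if "x \<in> carrier ?T" "y \<in> carrier ?T" for x y
      using cl[OF that] by simp
    show "mul ?T (mul ?T x y) z = mul ?T x (mul ?T y z)"
      if "x \<in> carrier ?T" "y \<in> carrier ?T" "z \<in> carrier ?T" for x y z
      using sS sub that unfolding is_semigroup_def by (simp add: subset_iff)
  qed
  have "?T \<in> V"
  proof -
    have "\<forall>S\<in>V. \<forall>T. is_semigroup T \<and> carrier T \<subseteq> carrier S
         \<and> (\<forall>x\<in>carrier T. \<forall>y\<in>carrier T. mul T x y = mul S x y) \<longrightarrow> T \<in> V"
      using V unfolding pseudovariety_def by blast
    moreover have "\<forall>x\<in>carrier ?T. \<forall>y\<in>carrier ?T. mul ?T x y = mul S x y" by simp
    ultimately show ?thesis using S sT sub by blast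
  qed
  moreover have "p \<in> sg_hom (free_sg A) ?T" using p by (auto simp: sg_hom_free)
  ultimately show ?thesis by (auto simp: quots_def)
qed

text \<open>Any finite set of components of a point of the limit is realised by a word: this is the
  directedness of the system of \<open>A\<close>-generated members of \<open>V\<close>.\<close>

lemma finite_components:
  assumes V: "pseudovariety V" and A: "A \<noteq> {}" and J: "finite J" "J \<subseteq> quots V A"
    and x: "x \<in> carrier (free_pro V A)"
  obtains w where "w \<in> carrier (free_sg A)" "\<And>i. i \<in> J \<Longrightarrow> x i = snd i w"
proof -
  obtain e where e: "bij_betw e {..<card J} J"
    using J(1) ex_bij_betw_nat_finite[of J] by (auto simp: lessThan_atLeast0)
  define n where "n = card J"
  define F where "F = (\<lambda>k. fst (e k))"
  define P where "P = sg_product {..<n} F"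
  have eJ: "e k \<in> J" if "k < n" for k using e that unfolding n_def bij_betw_def by auto
  have eQ: "e k \<in> quots V A" if "k < n" for k using eJ[OF that] J(2) by auto
  have FV: "F k \<in> V" if "k < n" for k using quot_mem[OF eQ[OF that]] by (simp add: F_def)
  have sF: "is_semigroup (F k)" "finite (carrier (F k))" if "k < n" for k
    using pv_sg[OF V] pv_finite[OF V] FV[OF that] by blast+
  have Pc: "carrier P = (\<Pi>\<^sub>E k\<in>{..<n}. carrier (F k))" by (simp add: P_def sg_product_def)
  have Pm: "mul P y z = (\<lambda>k\<in>{..<n}. mul (F k) (y k) (z k))" for y z
    by (simp add: P_def sg_product_def)
  have finP: "finite (carrier P)" unfolding Pc using sF by (intro finite_PiE) auto
  have Pne: "carrier P \<noteq> {}" unfolding Pc PiE_eq_empty_iff using sF(1) unfolding is_semigroup_def by blast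
  have Pcl: "mul P y z \<in> carrier P" if "y \<in> carrier P" "z \<in> carrier P" for y z
  proof -
    have "y k \<in> carrier (F k)" "z k \<in> carrier (F k)" if "k < n" for k
      using \<open>y \<in> _\<close> \<open>z \<in> _\<close> that unfolding Pc by (simp_all add: PiE_iff)
    then show ?thesis using sF(1) unfolding Pc Pm is_semigroup_def by simp
  qed
  have Pas: "mul P (mul P y z) u = mul P y (mul P z u)"
    if "y \<in> carrier P" "z \<in> carrier P" "u \<in> carrier P" for y z u
  proof -
    have "y k \<in> carrier (F k)" "z k \<in> carrier (F k)" "u k \<in> carrier (F k)" if "k < n" for k
      using \<open>y \<in> _\<close> \<open>z \<in> _\<close> \<open>u \<in> _\<close> that unfolding Pc by (simp_all add: PiE_iff)
    then show ?thesis using sF(1) unfolding Pm is_semigroup_def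
      by (intro restrict_ext) simp
  qed
  obtain g :: "(nat \<Rightarrow> nat) \<Rightarrow> nat" where g: "inj_on g (carrier P)"
    using finite_imp_inj_to_nat_seg[OF finP] by blast
  define g' where "g' = inv_into (carrier P) g"
  have g'g: "g' (g y) = y" if "y \<in> carrier P" for y using g that by (simp add: g'_def)
  define T where "T = \<lparr>carrier = g ` carrier P, mul = (\<lambda>a b. g (mul P (g' a) (g' b)))\<rparr>"
  have sT: "is_semigroup T"
    using Pne Pcl Pas unfolding is_semigroup_def T_def by (simp add: g'g)
  have "g \<in> sg_hom P T" unfolding sg_hom_def T_def by (simp add: g'g)
  then have iso: "sg_iso P T" using g by (auto simp: sg_iso_def bij_betw_def T_def)
  have TV: "T \<in> V" using V FV sT iso unfolding pseudovariety_def P_def by blast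
  define q where "q = (\<lambda>w. \<lambda>k\<in>{..<n}. snd (e k) w)"
  have hq: "snd (e k) \<in> sg_hom (free_sg A) (F k)" if "k < n" for k
    using quot_hom[OF eQ[OF that]] by (simp add: F_def)
  have qc: "q w \<in> carrier P" if "w \<in> carrier (free_sg A)" for w
    using hq that unfolding Pc q_def sg_hom_free by simp
  have qm: "q (u @ v) = mul P (q u) (q v)"
    if "u \<in> carrier (free_sg A)" "v \<in> carrier (free_sg A)" for u v
    using hq that unfolding Pm q_def sg_hom_free by (intro restrict_ext) simp
  define p where "p = (\<lambda>w. g (q w))"
  have p: "p \<in> sg_hom (free_sg A) T"
    unfolding sg_hom_free p_def T_def using qc qm by (simp add: g'g)
  define t where "t = (\<lparr>carrier = p ` carrier (free_sg A), mul = mul T\<rparr>, p)"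
  have t: "t \<in> quots V A" unfolding t_def by (rule image_quot[OF V A TV p])
  have "x t \<in> carrier (fst t)" using x t by (rule free_pro_at)
  then obtain w where w: "w \<in> carrier (free_sg A)" "x t = p w" by (auto simp: t_def)
  have xe: "x (e k) = snd (e k) w" if k: "k < n" for k
  proof -
    define h where "h = (\<lambda>a. g' a k)"
    have hp: "h (p u) = snd (e k) u" if "u \<in> carrier (free_sg A)" for u
      using k qc[OF that] by (simp add: h_def p_def g'g q_def)
    have "h (mul T (p u) (p v)) = mul (F k) (h (p u)) (h (p v))"
      if "u \<in> carrier (free_sg A)" "v \<in> carrier (free_sg A)" for u v
    proof -
      have "mul T (p u) (p v) = p (u @ v)" using p that by (auto simp: sg_hom_free)
      then show ?thesis using hp that hq[OF k] free_sg_closed[OF that] by (simp add: sg_hom_free)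
    qed
    then have "h \<in> sg_hom (fst t) (fst (e k))"
      using hp hq[OF k] unfolding sg_hom_free by (auto simp: sg_hom_def t_def F_def)
    then have "h \<in> quot_maps A (e k) t" using hp by (auto simp: quot_maps_def t_def)
    then have "h (x t) = x (e k)" using free_pro_compat[OF x eQ[OF k] t] by blast
    then show ?thesis using hp w by simp
  qed
  have "x i = snd i w" if "i \<in> J" for i
  proof -
    have "i \<in> e ` {..<n}" using e that by (simp add: bij_betw_def n_def)
    then obtain k where "k < n" "i = e k" by blast
    then show ?thesis using xe by blast
  qed
  with w(1) show ?thesis using that by blast
qed

lemma word_emb_dense:
  assumes "pseudovariety V" "A \<noteq> {}"
  shows "Abstract_Topology.closure_of (topo (free_pro V A)) (word_emb V A ` carrier (free_sg A)) = carrier (free_pro V A)"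
proof
  show "Abstract_Topology.closure_of (topo (free_pro V A)) (word_emb V A ` carrier (free_sg A)) \<subseteq> carrier (free_pro V A)"
    using closure_of_subset_topspace free_pro_topspace by metis
  show "carrier (free_pro V A) \<subseteq> Abstract_Topology.closure_of (topo (free_pro V A)) (word_emb V A ` carrier (free_sg A))"
  proof
    fix x assume x: "x \<in> carrier (free_pro V A)"
    have "\<exists>w\<in>carrier (free_sg A). word_emb V A w \<in> T"
      if T: "openin (topo (free_pro V A)) T" "x \<in> T" for T
    proof -
      obtain W where W: "openin (product_topology (\<lambda>i. discrete_topology (carrier (fst i))) (quots V A)) W"
        "T = W \<inter> carrier (free_pro V A)"
        using T(1) unfolding free_pro_topo openin_subtopology by blast
      obtain U where U: "finite {i \<in> quots V A. U i \<noteq> topspace (discrete_topology (carrier (fst i)))}"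
        "x \<in> PiE (quots V A) U" "PiE (quots V A) U \<subseteq> W"
        using W T(2) unfolding openin_product_topology_alt by blast
      let ?J = "{i \<in> quots V A. U i \<noteq> topspace (discrete_topology (carrier (fst i)))}"
      have "?J \<subseteq> quots V A" by auto
      then obtain w where w: "w \<in> carrier (free_sg A)" "\<And>i. i \<in> ?J \<Longrightarrow> x i = snd i w"
        using finite_components[OF assms U(1) _ x] by blast
      have "snd i w \<in> U i" if "i \<in> quots V A" for i
      proof (cases "i \<in> ?J")
        case True
        then show ?thesis using w(2)[OF True] U(2) that by (auto simp: PiE_iff)
      next
        case False
        then show ?thesis using quot_hom[OF that] w(1) that by (auto simp: sg_hom_free)
      qed
      then have "word_emb V A w \<in> PiE (quots V A) U" by (auto simp: word_emb_def)
      then show ?thesis using U(3) W(2) w(1) word_emb_carrier[OF w(1)] by blast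
    qed
    then show "x \<in> Abstract_Topology.closure_of (topo (free_pro V A)) (word_emb V A ` carrier (free_sg A))"
      using x by (auto simp: in_closure_of free_pro_topspace)
  qed
qed

lemma free_pro_Hausdorff: "Hausdorff_space (topo (free_pro V A))"
  unfolding free_pro_topo
  by (intro Hausdorff_space_subtopology)
     (simp add: Hausdorff_space_product_topology Hausdorff_space_discrete_topology)

text \<open>The universal property with respect to the members of \<open>V\<close>.\<close>

lemma free_pro_universal:
  assumes V: "pseudovariety V" and A: "A \<noteq> {}" and S: "S \<in> V" and f: "f \<in> sg_hom (free_sg A) S"
  shows "\<exists>!F. F \<in> extensional (carrier (free_pro V A)) \<and> F \<in> sg_hom (free_pro V A) S
    \<and> continuous_map (topo (free_pro V A)) (discrete_topology (carrier S)) F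
    \<and> (\<forall>w\<in>carrier (free_sg A). F (word_emb V A w) = f w)"
proof (rule ex_ex1I)
  define t where "t = (\<lparr>carrier = f ` carrier (free_sg A), mul = mul S\<rparr>, f)"
  have t: "t \<in> quots V A" unfolding t_def by (rule image_quot[OF V A S f])
  define F where "F = (\<lambda>x\<in>carrier (free_pro V A). x t)"
  have xt: "x t \<in> f ` carrier (free_sg A)" if "x \<in> carrier (free_pro V A)" for x
    using free_pro_at[OF that t] by (simp add: t_def)
  have xS: "x t \<in> carrier S" if "x \<in> carrier (free_pro V A)" for x
    using f xt[OF that] by (auto simp: sg_hom_free)
  have "continuous_map (topo (free_pro V A)) (discrete_topology (carrier (fst t))) (\<lambda>x. x t)"
    unfolding free_pro_topo
    by (intro continuous_map_from_subtopology continuous_map_product_projection t)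
  moreover have "continuous_map (discrete_topology (carrier (fst t))) (discrete_topology (carrier S)) id"
    using f by (auto simp: t_def sg_hom_free)
  ultimately have "continuous_map (topo (free_pro V A)) (discrete_topology (carrier S)) (id \<circ> (\<lambda>x. x t))"
    by (rule continuous_map_compose)
  then have "continuous_map (topo (free_pro V A)) (discrete_topology (carrier S)) F"
    by (rule continuous_map_eq) (simp add: F_def free_pro_topspace)
  moreover have "F \<in> sg_hom (free_pro V A) S"
    using xS free_pro_mul_closed[OF V] t by (auto simp: sg_hom_def F_def free_pro_mul t_def)
  moreover have "\<forall>w\<in>carrier (free_sg A). F (word_emb V A w) = f w"
    using word_emb_carrier[of _ A V] t by (auto simp: F_def word_emb_def t_def)
  ultimately show "\<exists>F. F \<in> extensional (carrier (free_pro V A)) \<and> F \<in> sg_hom (free_pro V A) S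
    \<and> continuous_map (topo (free_pro V A)) (discrete_topology (carrier S)) F
    \<and> (\<forall>w\<in>carrier (free_sg A). F (word_emb V A w) = f w)"
    by (intro exI[of _ F]) (auto simp: F_def)
next
  fix F G
  assume F: "F \<in> extensional (carrier (free_pro V A)) \<and> F \<in> sg_hom (free_pro V A) S
    \<and> continuous_map (topo (free_pro V A)) (discrete_topology (carrier S)) F
    \<and> (\<forall>w\<in>carrier (free_sg A). F (word_emb V A w) = f w)"
  and G: "G \<in> extensional (carrier (free_pro V A)) \<and> G \<in> sg_hom (free_pro V A) S
    \<and> continuous_map (topo (free_pro V A)) (discrete_topology (carrier S)) G
    \<and> (\<forall>w\<in>carrier (free_sg A). G (word_emb V A w) = f w)"
  show "F = G"
  proof (rule extensionalityI)
    show "F x = G x" if "x \<in> carrier (free_pro V A)" for x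
      by (rule forall_in_closure_of_eq[of x "topo (free_pro V A)" "word_emb V A ` carrier (free_sg A)"
           "discrete_topology (carrier S)"])
         (use F G that word_emb_dense[OF V A] in \<open>auto simp: Hausdorff_space_discrete_topology\<close>)
  qed (use F G in auto)
qed

lemma is_pro_ext_ex1:
  assumes V: "pseudovariety V" and A: "A \<noteq> {}" and f: "f \<in> sg_hom (free_sg A) (free_sg B)"
  shows "\<exists>!F. is_pro_ext V A B f F"
proof (rule ex_ex1I)
  have hi: "(\<lambda>w. snd i (f w)) \<in> sg_hom (free_sg A) (fst i)" if "i \<in> quots V B" for i
    using quot_hom[OF that] f by (auto simp: sg_hom_free) (auto simp: sg_hom_def free_sg_def)
  define G where "G = (\<lambda>i::'a quot. THE F. F \<in> extensional (carrier (free_pro V A)) \<and> F \<in> sg_hom (free_pro V A) (fst i)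
    \<and> continuous_map (topo (free_pro V A)) (discrete_topology (carrier (fst i))) F
    \<and> (\<forall>w\<in>carrier (free_sg A). F (word_emb V A w) = snd i (f w)))"
  have G: "G i \<in> extensional (carrier (free_pro V A)) \<and> G i \<in> sg_hom (free_pro V A) (fst i)
    \<and> continuous_map (topo (free_pro V A)) (discrete_topology (carrier (fst i))) (G i)
    \<and> (\<forall>w\<in>carrier (free_sg A). G i (word_emb V A w) = snd i (f w))" if "i \<in> quots V B" for i
    using theI'[OF free_pro_universal[OF V A quot_mem[OF that] hi[OF that]]] unfolding G_def .
  define F where "F = (\<lambda>x\<in>carrier (free_pro V A). \<lambda>i\<in>quots V B. G i x)"
  have thr: "h (G j x) = G i x"
    if ij: "i \<in> quots V B" "j \<in> quots V B" and h: "h \<in> quot_maps B i j"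
      and x: "x \<in> carrier (free_pro V A)" for i j h x
  proof (rule forall_in_closure_of_eq[of x "topo (free_pro V A)" "word_emb V A ` carrier (free_sg A)"
           "discrete_topology (carrier (fst i))" "\<lambda>x. h (G j x)" "G i"])
    show "x \<in> Abstract_Topology.closure_of (topo (free_pro V A)) (word_emb V A ` carrier (free_sg A))"
      using x word_emb_dense[OF V A] by simp
    have "continuous_map (discrete_topology (carrier (fst j))) (discrete_topology (carrier (fst i))) h"
      using h by (auto simp: quot_maps_def sg_hom_def)
    then have "continuous_map (topo (free_pro V A)) (discrete_topology (carrier (fst i))) (h \<circ> G j)"
      using G[OF ij(2)] continuous_map_compose by blast
    then show "continuous_map (topo (free_pro V A)) (discrete_topology (carrier (fst i))) (\<lambda>x. h (G j x))"
      by (simp add: o_def)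
    show "h (G j y) = G i y" if "y \<in> word_emb V A ` carrier (free_sg A)" for y
    proof -
      obtain w where w: "w \<in> carrier (free_sg A)" "y = word_emb V A w" using \<open>y \<in> _\<close> by auto
      have "f w \<in> carrier (free_sg B)" using f w(1) by (auto simp: sg_hom_def)
      then show ?thesis using G ij w h by (auto simp: quot_maps_def)
    qed
  qed (use G[OF ij(1)] in \<open>auto simp: Hausdorff_space_discrete_topology\<close>)
  have Gc: "G i x \<in> carrier (fst i)" if "i \<in> quots V B" "x \<in> carrier (free_pro V A)" for i x
    using G[OF that(1)] that(2) by (auto simp: sg_hom_def)
  have Fc: "F x \<in> carrier (free_pro V B)" if "x \<in> carrier (free_pro V A)" for x
    unfolding free_pro_carrier[of "F x"] using that thr[OF _ _ _ that] Gc by (simp add: F_def)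
  have Fh: "F \<in> sg_hom (free_pro V A) (free_pro V B)"
    unfolding sg_hom_def
  proof (intro CollectI conjI ballI)
    show "F \<in> carrier (free_pro V A) \<rightarrow> carrier (free_pro V B)" using Fc by auto
    show "F (mul (free_pro V A) x y) = mul (free_pro V B) (F x) (F y)"
      if "x \<in> carrier (free_pro V A)" "y \<in> carrier (free_pro V A)" for x y
      using that free_pro_mul_closed[OF V] G by (auto simp: F_def free_pro_mul[of V B] sg_hom_def fun_eq_iff)
  qed
  have Fcont: "continuous_map (topo (free_pro V A)) (topo (free_pro V B)) F"
    unfolding free_pro_topo[of V B] continuous_map_in_subtopology continuous_map_componentwise
  proof (intro conjI ballI)
    show "continuous_map (topo (free_pro V A)) (discrete_topology (carrier (fst i))) (\<lambda>x. F x i)"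
      if "i \<in> quots V B" for i
      by (rule continuous_map_eq[of _ _ "G i"]) (use G[OF that] that in \<open>auto simp: F_def free_pro_topspace\<close>)
  qed (use Fc in \<open>auto simp: free_pro_topspace F_def\<close>)
  have "\<forall>w\<in>carrier (free_sg A). F (word_emb V A w) = word_emb V B (f w)"
    using word_emb_carrier[of _ A V] G by (auto simp: F_def word_emb_def[of V B])
  then have "is_pro_ext V A B f F"
    using Fh Fcont by (auto simp: is_pro_ext_def F_def)
  then show "\<exists>F. is_pro_ext V A B f F" by blast
next
  fix F G assume FG: "is_pro_ext V A B f F" "is_pro_ext V A B f G"
  show "F = G"
  proof (rule extensionalityI)
    show "F x = G x" if "x \<in> carrier (free_pro V A)" for x
      by (rule forall_in_closure_of_eq[of x "topo (free_pro V A)" "word_emb V A ` carrier (free_sg A)"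
           "topo (free_pro V B)"])
         (use FG that word_emb_dense[OF V A] free_pro_Hausdorff in \<open>auto simp: is_pro_ext_def\<close>)
  qed (use FG in \<open>auto simp: is_pro_ext_def\<close>)
qed

end

theory Submission
  imports Defs "HOL-Algebra.Multiplicative_Group"
begin

text \<open>
  A primitive \<open>\<sigma>\<close> has a proper contraction iff for every \<open>n\<close> some \<open>\<sigma>\<^sub>n\<^sub>,\<^sub>m\<close> with \<open>m > n\<close> is proper.
  In that case let \<open>T\<close> be the eventual value of the images of \<open>A\<^sub>m\<^sup>+\<close> in a fixed finite
  \<open>A\<^sub>n\<close>-generated quotient. Properness makes left and right translation by the images of two
  fixed letters surjective on \<open>T\<close>, and positivity makes the image of every letter a factor of each
  of these two elements; as \<open>T\<close> is finite, translations by all elements are bijective and \<open>T\<close> is a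
  group. The image semigroup embeds into the product of these groups and is closed, hence
  contains the limits of \<open>x\<^bsup>k!\<^esup>\<close> and \<open>x\<^bsup>2k!-1\<^esup>\<close>, which are its identity and the inverse of \<open>x\<close>.
  Conversely, left-zero and right-zero semigroups belong to \<open>LSl\<close>, and a group has only constant
  homomorphisms into them, so by compactness some \<open>\<sigma>\<^sub>n\<^sub>,\<^sub>m\<close> has constant first and last letters.
  Finally, the projections of the inverse limit are onto by compactness.
\<close>

section \<open>Free profinite semigroups\<close>

text \<open>Each condition \<open>h (x j) = x i\<close> equates two continuous maps into a discrete,
  hence Hausdorff, space and so cuts out a closed set; the carrier is the intersection of these
  sets.\<close>

lemma free_pro_closedin:
  fixes V A
  defines "X \<equiv> product_topology (\<lambda>i. discrete_topology (carrier (fst i))) (quots V A)"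
  shows "closedin X (carrier (free_pro V A))"
proof -
  define K where "K = (\<lambda>(i, j, h). {x \<in> topspace X. h (x j) = x i})"
  define J where "J = {(i, j, h). i \<in> quots V A \<and> j \<in> quots V A \<and> h \<in> quot_maps A i j}"
  have proj: "continuous_map X (discrete_topology (carrier (fst i))) (\<lambda>x. x i)"
    if "i \<in> quots V A" for i
    unfolding X_def by (rule continuous_map_product_projection[OF that])
  have "closedin X (K t)" if "t \<in> J" for t
  proof -
    obtain i j h where t: "t = (i, j, h)" by (cases t)
    have ij: "i \<in> quots V A" "j \<in> quots V A" "h \<in> quot_maps A i j" using that by (auto simp: J_def t)
    have "continuous_map (discrete_topology (carrier (fst j))) (discrete_topology (carrier (fst i))) h"
      using ij by (auto simp: quot_maps_def sg_hom_def)
    then have "continuous_map X (discrete_topology (carrier (fst i))) (h \<circ> (\<lambda>x. x j))"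
      using proj[OF ij(2)] continuous_map_compose by blast
    from closedin_continuous_maps_eq[OF _ this proj[OF ij(1)]] show ?thesis
      by (simp add: Hausdorff_space_discrete_topology K_def t)
  qed
  \<comment> \<open>The whole space joins the family because \<open>J\<close> may be empty for
    arbitrary \<open>V\<close> and \<open>A\<close>, and an empty intersection would be the
    universal set.\<close>
  then have "closedin X (\<Inter> (insert (topspace X) (K ` J)))"
    by (intro closedin_Inter) auto
  moreover have "\<Inter> (insert (topspace X) (K ` J)) = carrier (free_pro V A)"
  proof (rule Set.set_eqI)
    fix x
    have "x \<in> \<Inter> (insert (topspace X) (K ` J)) \<longleftrightarrow> x \<in> topspace X \<and> (\<forall>t\<in>J. x \<in> K t)"
      by blast
    also have "\<dots> \<longleftrightarrow> x \<in> topspace X \<and>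
        (\<forall>i\<in>quots V A. \<forall>j\<in>quots V A. \<forall>h\<in>quot_maps A i j. h (x j) = x i)"
      unfolding J_def K_def by auto
    also have "\<dots> \<longleftrightarrow> x \<in> carrier (free_pro V A)"
      unfolding free_pro_carrier by (simp add: X_def)
    finally show "x \<in> \<Inter> (insert (topspace X) (K ` J)) \<longleftrightarrow> x \<in> carrier (free_pro V A)" .
  qed
  ultimately show ?thesis by simp
qed

text \<open>Tychonoff's theorem for finite discrete factors, followed by closedness of the
  carrier.\<close>

lemma free_pro_compact:
  assumes "pseudovariety V"
  shows "compactin (product_topology (\<lambda>i. discrete_topology (carrier (fst i))) (quots V A))
           (carrier (free_pro V A))"
proof (rule closedin_compact_space[OF _ free_pro_closedin])
  have "compact_space (discrete_topology (carrier (fst i)))" if "i \<in> quots V A" for i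
    using pv_finite[OF assms quot_mem[OF that]] by (simp add: compact_space_discrete_topology)
  then show "compact_space (product_topology (\<lambda>i. discrete_topology (carrier (fst i))) (quots V A))"
    by (simp add: compact_space_product_topology)
qed

lemma free_pro_compact_space: "pseudovariety V \<Longrightarrow> compact_space (topo (free_pro V A))"
  unfolding free_pro_topo by (intro compact_space_subtopology free_pro_compact)

lemma free_pro_continuous_at:
  "i \<in> quots V A \<Longrightarrow>
     continuous_map (topo (free_pro V A)) (discrete_topology (carrier (fst i))) (\<lambda>x. x i)"
  unfolding free_pro_topo
  by (intro continuous_map_from_subtopology continuous_map_product_projection)

text \<open>Every set of values is closed in a discrete factor. This lets compactness arguments
  impose arbitrary conditions on a single coordinate.\<close>

lemma free_pro_closedin_at:
  assumes "i \<in> quots V A"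
  shows "closedin (topo (free_pro V A)) {x \<in> carrier (free_pro V A). x i \<in> Z}"
proof -
  have "closedin (topo (free_pro V A))
          {x \<in> topspace (topo (free_pro V A)). x i \<in> Z \<inter> carrier (fst i)}"
    by (rule closedin_continuous_map_preimage[OF free_pro_continuous_at[OF assms]]) simp
  moreover have "{x \<in> topspace (topo (free_pro V A)). x i \<in> Z \<inter> carrier (fst i)}
      = {x \<in> carrier (free_pro V A). x i \<in> Z}"
    using free_pro_at[OF _ assms] by (auto simp: free_pro_topspace)
  ultimately show ?thesis by simp
qed

text \<open>The continuous extension of \<open>f\<close> is a reindexing of coordinates along \<open>pull_quot A f\<close>
  (\<open>pro_ext_eq\<close> below), which makes functoriality a statement about indices.\<close>

definition pull_quot :: "'a set \<Rightarrow> ('a list \<Rightarrow> 'a list) \<Rightarrow> 'a quot \<Rightarrow> 'a quot" where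
  "pull_quot A f i =
     (\<lparr>carrier = (snd i \<circ> f) ` carrier (free_sg A), mul = mul (fst i)\<rparr>, snd i \<circ> f)"

lemma pull_quot_mem:
  assumes "pseudovariety V" "A \<noteq> {}" "f \<in> sg_hom (free_sg A) (free_sg B)" "i \<in> quots V B"
  shows "pull_quot A f i \<in> quots V A"
proof -
  have "snd i \<circ> f \<in> sg_hom (free_sg A) (fst i)"
    using quot_hom[OF assms(4)] assms(3)
    by (auto simp: sg_hom_free) (auto simp: sg_hom_def free_sg_def)
  then show ?thesis
    unfolding pull_quot_def using assms by (intro image_quot quot_mem)
qed

lemma pull_quot_comp: "pull_quot A f (pull_quot B g i) = pull_quot A (g \<circ> f) i"
  by (simp add: pull_quot_def o_assoc)

text \<open>The generating map of a member of \<open>quots\<close> is onto, so shrinking the carrier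
  to its image changes nothing.\<close>

lemma pull_quot_id: "i \<in> quots V A \<Longrightarrow> pull_quot A id i = i"
  by (cases i) (auto simp: pull_quot_def quots_def)

text \<open>Pulling back keeps the multiplication and only shrinks carriers, so the same
  \<open>h\<close> still connects the quotients. Hence reindexing preserves the compatibility of
  points of the limit.\<close>

lemma pull_quot_map:
  assumes f: "f \<in> sg_hom (free_sg A) (free_sg B)" and ij: "i \<in> quots V B" "j \<in> quots V B"
    and h: "h \<in> quot_maps B i j"
  shows "h \<in> quot_maps A (pull_quot A f i) (pull_quot A f j)"
proof -
  have fw: "f w \<in> carrier (free_sg B)" if "w \<in> carrier (free_sg A)" for w
    using f that by (auto simp: sg_hom_def)
  have hw: "h (snd j (f w)) = snd i (f w)" if "w \<in> carrier (free_sg A)" for w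
    using h fw[OF that] by (auto simp: quot_maps_def)
  have "snd j (f w) \<in> carrier (fst j)" if "w \<in> carrier (free_sg A)" for w
    using quot_hom[OF ij(2)] fw[OF that] by (simp add: sg_hom_free)
  then show ?thesis
    using h hw by (auto simp: quot_maps_def pull_quot_def sg_hom_def)
qed

text \<open>The quotient \<open>pull_quot A f i\<close> is generated by
  \<open>snd i \<circ> f\<close>, so on an embedded word its coordinate is coordinate
  \<open>i\<close> of the embedded \<open>f\<close>-image. Continuity is coordinatewise, each
  coordinate of the map being a projection.\<close>

lemma is_pro_ext_pull:
  assumes V: "pseudovariety V" and A: "A \<noteq> {}" and f: "f \<in> sg_hom (free_sg A) (free_sg B)"
  shows "is_pro_ext V A B f (\<lambda>x\<in>carrier (free_pro V A). \<lambda>i\<in>quots V B. x (pull_quot A f i))"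
    (is "is_pro_ext V A B f ?F")
proof -
  have pull: "pull_quot A f i \<in> quots V A" if "i \<in> quots V B" for i
    by (rule pull_quot_mem[OF V A f that])
  have fw: "f w \<in> carrier (free_sg B)" if "w \<in> carrier (free_sg A)" for w
    using f that by (auto simp: sg_hom_def)
  have sub: "carrier (fst (pull_quot A f i)) \<subseteq> carrier (fst i)" if "i \<in> quots V B" for i
    using quot_hom[OF that] fw by (auto simp: pull_quot_def sg_hom_free)
  have Fc: "?F x \<in> carrier (free_pro V B)" if x: "x \<in> carrier (free_pro V A)" for x
    unfolding free_pro_carrier[of "?F x"]
    using free_pro_at[OF x pull] sub x free_pro_compat[OF x pull pull pull_quot_map[OF f]]
    by (fastforce simp: subset_iff)
  have "?F \<in> sg_hom (free_pro V A) (free_pro V B)"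
    using Fc free_pro_mul_closed[OF V] pull
    by (auto simp: sg_hom_def free_pro_mul pull_quot_def fun_eq_iff)
  moreover have "continuous_map (topo (free_pro V A)) (topo (free_pro V B)) ?F"
    unfolding free_pro_topo[of V B] continuous_map_in_subtopology continuous_map_componentwise
  proof (intro conjI ballI)
    fix i assume i: "i \<in> quots V B"
    \<comment> \<open>The pulled-back carrier is only a subset of \<open>carrier (fst i)\<close>, so
      the projection is followed by the inclusion.\<close>
    have "continuous_map (discrete_topology (carrier (fst (pull_quot A f i))))
            (discrete_topology (carrier (fst i))) id"
      using sub[OF i] by auto
    from continuous_map_compose[OF free_pro_continuous_at[OF pull[OF i]] this]
    show "continuous_map (topo (free_pro V A)) (discrete_topology (carrier (fst i))) (\<lambda>x. ?F x i)"
      by (rule continuous_map_eq) (simp add: i free_pro_topspace)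
  qed (use Fc in \<open>auto simp: free_pro_topspace\<close>)
  moreover have "\<forall>w\<in>carrier (free_sg A). ?F (word_emb V A w) = word_emb V B (f w)"
    using word_emb_carrier[of _ A V] pull by (auto simp: word_emb_def pull_quot_def fun_eq_iff)
  ultimately show ?thesis by (auto simp: is_pro_ext_def)
qed

lemma pro_ext_eq:
  assumes "pseudovariety V" "A \<noteq> {}" "f \<in> sg_hom (free_sg A) (free_sg B)"
  shows "pro_ext V A B f = (\<lambda>x\<in>carrier (free_pro V A). \<lambda>i\<in>quots V B. x (pull_quot A f i))"
  unfolding pro_ext_def
  using is_pro_ext_pull[OF assms] is_pro_ext_ex1[OF assms] by (rule the1_equality[rotated])

lemma pro_ext_is_pro_ext:
  assumes "pseudovariety V" "A \<noteq> {}" "f \<in> sg_hom (free_sg A) (free_sg B)"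
  shows "is_pro_ext V A B f (pro_ext V A B f)"
  using is_pro_ext_pull[OF assms] by (simp add: pro_ext_eq[OF assms])

section \<open>Groups among semigroups\<close>

text \<open>Solvability of all equations on both sides yields a left identity and left
  inverses.\<close>

lemma is_groupI:
  assumes S: "is_semigroup S"
    and l: "\<And>x y. x \<in> carrier S \<Longrightarrow> y \<in> carrier S \<Longrightarrow> \<exists>z\<in>carrier S. mul S x z = y"
    and r: "\<And>x y. x \<in> carrier S \<Longrightarrow> y \<in> carrier S \<Longrightarrow> \<exists>z\<in>carrier S. mul S z x = y"
  shows "is_group S"
proof -
  obtain t where t: "t \<in> carrier S" using S by (auto simp: is_semigroup_def)
  obtain e where e: "e \<in> carrier S" "mul S e t = t" using r[OF t t] by blast
  \<comment> \<open>The element \<open>e\<close> fixes \<open>t\<close> from the left, and every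
    \<open>x\<close> has the form \<open>t y\<close>.\<close>
  have "mul S e x = x" if x: "x \<in> carrier S" for x
  proof -
    obtain y where y: "y \<in> carrier S" "mul S t y = x" using l[OF t x] by blast
    have "mul S e (mul S t y) = mul S (mul S e t) y"
      using S e(1) t y(1) by (simp add: is_semigroup_def)
    then show ?thesis using e(2) y(2) by simp
  qed
  then have "group \<lparr>carrier = carrier S, monoid.mult = mul S, one = e\<rparr>"
    using S e r by (intro groupI) (auto simp: is_semigroup_def)
  then show ?thesis by (auto simp: is_group_def)
qed

lemma is_groupE:
  assumes "is_group S"
  obtains e where "e \<in> carrier S" "\<And>x. x \<in> carrier S \<Longrightarrow> mul S e x = x"
    "\<And>x. x \<in> carrier S \<Longrightarrow> mul S x e = x"
    "\<And>x. x \<in> carrier S \<Longrightarrow> \<exists>y\<in>carrier S. mul S x y = e \<and> mul S y x = e"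
    "is_semigroup S"
proof -
  obtain e where "group \<lparr>carrier = carrier S, monoid.mult = mul S, one = e\<rparr>" (is "group ?G")
    using assms by (auto simp: is_group_def)
  then interpret group ?G .
  show ?thesis
  proof (rule that)
    show "e \<in> carrier S" using one_closed by simp
    show "mul S e x = x" "mul S x e = x" if "x \<in> carrier S" for x using l_one r_one that by auto
    show "\<exists>y\<in>carrier S. mul S x y = e \<and> mul S y x = e" if "x \<in> carrier S" for x
      using l_inv r_inv that inv_closed by force
    show "is_semigroup S"
      using one_closed m_closed m_assoc by (auto simp: is_semigroup_def)
  qed
qed

text \<open>Multiplying \<open>e e = e\<close> by an inverse of \<open>e\<close> shows that
  \<open>e\<close> is the identity. As \<open>is_group\<close> hides the unit, idempotency serves to
  recognise it.\<close>

lemma is_group_idem: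
  assumes "is_group S" "e \<in> carrier S" "mul S e e = e" "x \<in> carrier S"
  shows "mul S e x = x" "mul S x e = x"
proof -
  obtain u where u: "u \<in> carrier S" "\<And>x. x \<in> carrier S \<Longrightarrow> mul S u x = x"
    "\<And>x. x \<in> carrier S \<Longrightarrow> mul S x u = x"
    "\<And>x. x \<in> carrier S \<Longrightarrow> \<exists>y\<in>carrier S. mul S x y = u \<and> mul S y x = u" "is_semigroup S"
    by (rule is_groupE[OF assms(1)]) (rule that)
  obtain y where y: "y \<in> carrier S" "mul S y e = u" using u(4)[OF assms(2)] by blast
  have "e = mul S (mul S y e) e" using y u(2) assms(2) by simp
  also have "\<dots> = mul S y (mul S e e)" using y(1) assms(2) u(5) by (simp add: is_semigroup_def)
  also have "\<dots> = u" using assms(3) y(2) by simp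
  finally show "mul S e x = x" "mul S x e = x" using u(2,3) assms(4) by simp_all
qed

lemma is_group_image:
  assumes "is_group S" "h \<in> sg_hom S T" "h ` carrier S = carrier T"
  shows "is_group T"
proof -
  obtain e where e: "e \<in> carrier S" "\<And>x. x \<in> carrier S \<Longrightarrow> mul S e x = x"
    "\<And>x. x \<in> carrier S \<Longrightarrow> mul S x e = x"
    "\<And>x. x \<in> carrier S \<Longrightarrow> \<exists>y\<in>carrier S. mul S x y = e \<and> mul S y x = e" "is_semigroup S"
    by (rule is_groupE[OF assms(1)]) (rule that)
  have h: "mul T (h x) (h y) = h (mul S x y)" if "x \<in> carrier S" "y \<in> carrier S" for x y
    using assms(2) that by (auto simp: sg_hom_def)
  have cl: "mul S x y \<in> carrier S" if "x \<in> carrier S" "y \<in> carrier S" for x y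
    using e(5) that by (auto simp: is_semigroup_def)
  have T: "carrier T = h ` carrier S" using assms(3) by simp
  have "group \<lparr>carrier = carrier T, monoid.mult = mul T, one = h e\<rparr>"
  proof (rule groupI, unfold T partial_object.simps monoid.simps)
    show "mul T x y \<in> h ` carrier S" if xy: "x \<in> h ` carrier S" "y \<in> h ` carrier S" for x y
      using xy by (elim imageE) (simp add: h cl)
    show "h e \<in> h ` carrier S" using e(1) by (rule imageI)
    show "mul T (mul T x y) z = mul T x (mul T y z)"
      if xyz: "x \<in> h ` carrier S" "y \<in> h ` carrier S" "z \<in> h ` carrier S" for x y z
      using xyz e(5) by (elim imageE) (simp add: h cl is_semigroup_def)
    show "mul T (h e) x = x" if "x \<in> h ` carrier S" for x
      using that e(1) by (elim imageE) (simp add: h e(2))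
    show "\<exists>y\<in>h ` carrier S. mul T y x = h e" if x: "x \<in> h ` carrier S" for x
    proof -
      obtain s where s: "s \<in> carrier S" "x = h s" using x by blast
      obtain t where "t \<in> carrier S" "mul S t s = e" using e(4)[OF s(1)] by blast
      then show ?thesis using s by (intro bexI[of _ "h t"]) (simp_all add: h)
    qed
  qed
  then show ?thesis by (auto simp: is_group_def)
qed

section \<open>Words and homomorphisms of free semigroups\<close>

lemma free_sg_singleton: "a \<in> A \<Longrightarrow> [a] \<in> carrier (free_sg A)"
  by (simp add: free_sg_def)

lemma free_sg_hd: "w \<in> carrier (free_sg A) \<Longrightarrow> hd w \<in> A"
  and free_sg_last: "w \<in> carrier (free_sg A) \<Longrightarrow> last w \<in> A"
  by (auto simp: free_sg_def)

lemma free_hom_closed: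
  "f \<in> sg_hom (free_sg A) (free_sg B) \<Longrightarrow> w \<in> carrier (free_sg A) \<Longrightarrow> f w \<in> carrier (free_sg B)"
  by (simp add: sg_hom_free)

lemma free_hom_append:
  assumes "f \<in> sg_hom (free_sg A) (free_sg B)" "u \<in> carrier (free_sg A)" "v \<in> carrier (free_sg A)"
  shows "f (u @ v) = f u @ f v"
  using assms by (auto simp: sg_hom_def free_sg_def)

text \<open>All three claims hold because \<open>f [hd w]\<close> is a nonempty prefix of
  \<open>f w\<close>.\<close>

lemma free_hom_hd:
  assumes f: "f \<in> sg_hom (free_sg A) (free_sg B)" and w: "w \<in> carrier (free_sg A)"
  shows "hd (f w) = hd (f [hd w])" "set (f [hd w]) \<subseteq> set (f w)"
    "length (f [hd w]) \<le> length (f w)"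
proof -
  obtain a u where au: "w = a # u" using w by (cases w) (auto simp: free_sg_def)
  have "hd (f w) = hd (f [a]) \<and> set (f [a]) \<subseteq> set (f w) \<and> length (f [a]) \<le> length (f w)"
  proof (cases "u = []")
    case False
    then have "f ([a] @ u) = f [a] @ f u"
      using w au by (intro free_hom_append[OF f]) (auto simp: free_sg_def)
    moreover have "f [a] \<noteq> []"
      using free_hom_closed[OF f, of "[a]"] w au by (auto simp: free_sg_def)
    ultimately show ?thesis using au by simp
  qed (use au in simp)
  then show "hd (f w) = hd (f [hd w])" "set (f [hd w]) \<subseteq> set (f w)"
    "length (f [hd w]) \<le> length (f w)" using au by auto
qed

lemma free_hom_last:
  assumes f: "f \<in> sg_hom (free_sg A) (free_sg B)" and w: "w \<in> carrier (free_sg A)"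
  shows "last (f w) = last (f [last w])"
proof -
  obtain a u where au: "w = u @ [a]" using w by (cases w rule: rev_cases) (auto simp: free_sg_def)
  show ?thesis
  proof (cases "u = []")
    case False
    then have "f (u @ [a]) = f u @ f [a]"
      using w au by (intro free_hom_append[OF f]) (auto simp: free_sg_def)
    moreover have "f [a] \<noteq> []"
      using free_hom_closed[OF f, of "[a]"] w au by (auto simp: free_sg_def)
    ultimately show ?thesis using au by simp
  qed (use au in simp)
qed

text \<open>As the image of \<open>p\<close> is finite, a surjective translation by a product makes the translations by its
  factors bijective; every \<open>p [a]\<close> is an inner factor of \<open>p [b]\<close> and of \<open>p [c]\<close>.\<close>

lemma finite_image_is_group:
  fixes S :: "('x, 'c) sgrp_scheme"
  assumes S: "is_semigroup S" and p: "p \<in> sg_hom (free_sg B) S"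
    and fin: "finite (p ` carrier (free_sg B))" and bc: "b \<in> B" "c \<in> B"
    and wit: "\<And>x. x \<in> p ` carrier (free_sg B) \<Longrightarrow> \<exists>w\<in>carrier (free_sg B).
        p w = x \<and> hd w = b \<and> last w = c \<and> B \<subseteq> set w \<and> 2 \<le> length w"
  shows "is_group (\<lparr>carrier = p ` carrier (free_sg B), mul = mul S\<rparr> :: 'x sgrp)"
proof -
  let ?W = "carrier (free_sg B)"
  define T where "T = p ` ?W"
  have pT: "p w \<in> T" if "w \<in> ?W" for w using that by (simp add: T_def)
  have pm: "p (u @ v) = mul S (p u) (p v)" if "u \<in> ?W" "v \<in> ?W" for u v
    using p that by (simp add: sg_hom_free)
  have TS: "x \<in> carrier S" if "x \<in> T" for x using p that by (auto simp: T_def sg_hom_free)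
  have cl: "mul S x y \<in> T" if xy: "x \<in> T" "y \<in> T" for x y
  proof -
    obtain u v where "u \<in> ?W" "v \<in> ?W" "x = p u" "y = p v" using xy by (auto simp: T_def)
    then show ?thesis using pm[of u v] pT[OF free_sg_closed[of u B v]] by simp
  qed
  have as: "mul S (mul S x y) z = mul S x (mul S y z)" if "x \<in> T" "y \<in> T" "z \<in> T" for x y z
    using S TS that by (simp add: is_semigroup_def)
  \<comment> \<open>Split the leading \<open>b\<close> off a witness for \<open>x\<close>; length at
    least 2 keeps the rest a nonempty word.\<close>
  have l_div: "\<exists>y\<in>T. mul S (p [b]) y = x" if x: "x \<in> T" for x
  proof -
    obtain w where w: "w \<in> ?W" "p w = x" "hd w = b" "2 \<le> length w"
      using wit[OF x[unfolded T_def]] by blast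
    then have "w = [b] @ tl w" "tl w \<in> ?W"
      by (cases w; cases "tl w"; auto simp: free_sg_def)+
    then show ?thesis using w(2) pm[of "[b]" "tl w"] pT bc free_sg_singleton by metis
  qed
  have r_div: "\<exists>y\<in>T. mul S y (p [c]) = x" if x: "x \<in> T" for x
  proof -
    obtain w where w: "w \<in> ?W" "p w = x" "last w = c" "2 \<le> length w"
      using wit[OF x[unfolded T_def]] by blast
    then have "w = butlast w @ [c]" "butlast w \<in> ?W"
      by (cases w rule: rev_cases; auto simp: free_sg_def)+
    then show ?thesis using w(2) pm[of "butlast w" "[c]"] pT bc free_sg_singleton by metis
  qed
  \<comment> \<open>First \<open>b\<close> is split off on the left, then \<open>c\<close> on the
    right, and the remaining element is represented by a word containing \<open>a\<close>. The
    letters \<open>b\<close> and \<open>c\<close> keep both outer factors nonempty.\<close>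
  have factor: "\<exists>u\<in>T. \<exists>v\<in>T. x = mul S (mul S u (p [a])) v" if x: "x \<in> T" and a: "a \<in> B" for x a
  proof -
    obtain y where y: "y \<in> T" "mul S (p [b]) y = x" using l_div[OF x] by blast
    obtain z where z: "z \<in> T" "mul S z (p [c]) = y" using r_div[OF y(1)] by blast
    obtain w where w: "w \<in> ?W" "p w = z" "a \<in> set w"
      using wit[OF z(1)[unfolded T_def]] a by blast
    obtain w1 w2 where w12: "w = w1 @ [a] @ w2" using split_list[OF w(3)] by auto
    have W: "[b] @ w1 \<in> ?W" "[a] \<in> ?W" "w2 @ [c] \<in> ?W" "[b] \<in> ?W" "[c] \<in> ?W"
      using w(1) w12 bc a by (auto simp: free_sg_def)
    have "x = p ([b] @ (w @ [c]))"
      using y z w W by (simp only: pm free_sg_closed)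
    also have "\<dots> = p ((([b] @ w1) @ [a]) @ (w2 @ [c]))" by (simp add: w12)
    also have "\<dots> = mul S (mul S (p ([b] @ w1)) (p [a])) (p (w2 @ [c]))"
      using W by (simp only: pm free_sg_closed)
    finally show ?thesis using pT W by blast
  qed
  have fT: "finite T" using fin by (simp add: T_def)
  have bT: "p [b] \<in> T" and cT: "p [c] \<in> T" using bc pT free_sg_singleton by metis+
  \<comment> \<open>Writing \<open>p [b] = u (p [a]) v\<close> makes left translation by
    \<open>u\<close> surjective on the finite set \<open>T\<close>, hence injective. To reach
    \<open>y\<close>, solve \<open>p [b] x = u y\<close> and cancel \<open>u\<close>.\<close>
  have l_gen: "mul S (p [a]) ` T = T" if a: "a \<in> B" for a
  proof
    have aT: "p [a] \<in> T" using a pT free_sg_singleton by metis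
    then show "mul S (p [a]) ` T \<subseteq> T" using cl by blast
    obtain u v where uv: "u \<in> T" "v \<in> T" "p [b] = mul S (mul S u (p [a])) v"
      using factor[OF bT a] by blast
    have pb: "mul S (p [b]) x = mul S u (mul S (p [a]) (mul S v x))" if "x \<in> T" for x
      using uv that aT by (simp add: cl as)
    have "T \<subseteq> mul S u ` T"
      using l_div pb uv aT cl by (metis image_eqI subsetI)
    then have "mul S u ` T = T" using cl uv by blast
    then have inj: "inj_on (mul S u) T" using fT by (intro eq_card_imp_inj_on) auto
    show "T \<subseteq> mul S (p [a]) ` T"
    proof
      fix y assume y: "y \<in> T"
      obtain x where x: "x \<in> T" "mul S (p [b]) x = mul S u y" using l_div[OF cl[OF uv(1) y]] by blast
      have "y = mul S (p [a]) (mul S v x)"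
        using inj y x pb[OF x(1)] uv aT cl by (auto simp: inj_on_def)
      then show "y \<in> mul S (p [a]) ` T" using cl uv x by blast
    qed
  qed
  have r_gen: "(\<lambda>x. mul S x (p [a])) ` T = T" if a: "a \<in> B" for a
  proof
    have aT: "p [a] \<in> T" using a pT free_sg_singleton by metis
    then show "(\<lambda>x. mul S x (p [a])) ` T \<subseteq> T" using cl by blast
    obtain u v where uv: "u \<in> T" "v \<in> T" "p [c] = mul S (mul S u (p [a])) v"
      using factor[OF cT a] by blast
    have pb: "mul S x (p [c]) = mul S (mul S (mul S x u) (p [a])) v" if "x \<in> T" for x
      using uv that aT by (simp add: cl as)
    have "T \<subseteq> (\<lambda>x. mul S x v) ` T"
      using r_div pb uv aT cl by (metis (no_types, lifting) image_eqI subsetI)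
    then have "(\<lambda>x. mul S x v) ` T = T" using cl uv by blast
    then have inj: "inj_on (\<lambda>x. mul S x v) T" using fT by (intro eq_card_imp_inj_on) auto
    show "T \<subseteq> (\<lambda>x. mul S x (p [a])) ` T"
    proof
      fix y assume y: "y \<in> T"
      obtain x where x: "x \<in> T" "mul S x (p [c]) = mul S y v" using r_div[OF cl[OF y uv(2)]] by blast
      have "y = mul S (mul S x u) (p [a])"
        using inj y x pb[OF x(1)] uv aT cl by (auto simp: inj_on_def)
      then show "y \<in> (\<lambda>x. mul S x (p [a])) ` T" using cl uv x by blast
    qed
  qed
  \<comment> \<open>Translation by a product is a composite of translations by letters, so
    surjectivity spreads to all of \<open>T\<close> by induction on words.\<close>
  have all: "mul S (p w) ` T = T \<and> (\<lambda>x. mul S x (p w)) ` T = T" if "w \<in> ?W" for w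
    using that
  proof (induction w)
    case (Cons a w)
    have a: "a \<in> B" "[a] \<in> ?W" using Cons.prems by (auto simp: free_sg_def)
    show ?case
    proof (cases "w = []")
      case True
      then show ?thesis using l_gen r_gen a by simp
    next
      case False
      then have w: "w \<in> ?W" using Cons.prems by (auto simp: free_sg_def)
      have aT: "p [a] \<in> T" and wT: "p w \<in> T" using a w pT by blast+
      have pw: "p (a # w) = mul S (p [a]) (p w)" using pm[OF a(2) w] by simp
      have "mul S (p (a # w)) ` T = mul S (p [a]) ` (mul S (p w) ` T)"
        unfolding image_image pw by (intro image_cong) (simp_all add: as aT wT)
      moreover have "(\<lambda>x. mul S x (p (a # w))) ` T
          = (\<lambda>x. mul S x (p w)) ` ((\<lambda>x. mul S x (p [a])) ` T)"
        unfolding image_image pw by (intro image_cong) (simp_all add: as aT wT)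
      ultimately show ?thesis using Cons.IH[OF w] l_gen r_gen a by simp
    qed
  qed (simp add: free_sg_def)
  have lr: "\<exists>z\<in>T. mul S x z = y" "\<exists>z\<in>T. mul S z x = y" if xy: "x \<in> T" "y \<in> T" for x y
  proof -
    obtain w where "w \<in> ?W" "x = p w" using xy by (auto simp: T_def)
    then have "y \<in> mul S x ` T" "y \<in> (\<lambda>z. mul S z x) ` T" using all xy by simp_all
    then show "\<exists>z\<in>T. mul S x z = y" "\<exists>z\<in>T. mul S z x = y" by auto
  qed
  have "is_group (\<lparr>carrier = T, mul = mul S\<rparr> :: 'x sgrp)"
    by (rule is_groupI) (use bT cl as lr in \<open>auto simp: is_semigroup_def\<close>)
  then show ?thesis by (simp add: T_def)
qed

section \<open>Compositions of a directive sequence\<close>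

lemma sig_comp_refl [simp]: "sig_comp \<sigma> n n = id"
  by (simp add: sig_comp_def)

lemma sig_comp_Cons: "n < m \<Longrightarrow> sig_comp \<sigma> n m = \<sigma> n \<circ> sig_comp \<sigma> (Suc n) m"
  by (simp add: sig_comp_def upt_conv_Cons)

lemma sig_comp_trans:
  assumes "n \<le> m" "m \<le> p"
  shows "sig_comp \<sigma> n m \<circ> sig_comp \<sigma> m p = sig_comp \<sigma> n p"
  using assms(1)
proof (induction n rule: inc_induct)
  case (step n)
  then show ?case using assms(2) by (simp add: sig_comp_Cons fun_eq_iff)
qed simp

lemma sig_comp_shift: "sig_comp (seq_shift k \<sigma>) 0 m = sig_comp \<sigma> k (m + k)"
proof -
  have "map (seq_shift k \<sigma>) [0..<m] = map \<sigma> (map (\<lambda>n. n + k) [0..<m])"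
    by (simp add: seq_shift_def)
  then show ?thesis by (simp add: sig_comp_def map_add_upt)
qed

lemma sg_hom_comp: "g \<in> sg_hom S T \<Longrightarrow> h \<in> sg_hom R S \<Longrightarrow> g \<circ> h \<in> sg_hom R T"
  by (auto simp: sg_hom_def Pi_iff)

text \<open>Stated for all words rather than letters, so that it can be applied directly to words
  that are themselves images under a homomorphism.\<close>

definition proper_image :: "'a set \<Rightarrow> 'a set \<Rightarrow> ('a list \<Rightarrow> 'a list) \<Rightarrow> bool" where
  "proper_image A B f \<longleftrightarrow>
     (\<exists>b\<in>B. \<exists>c\<in>B. \<forall>w\<in>carrier (free_sg A). hd (f w) = b \<and> last (f w) = c)"

lemma proper_image_iff:
  assumes "f \<in> sg_hom (free_sg A) (free_sg B)"
  shows "proper_image A B f \<longleftrightarrow> left_proper A B f \<and> right_proper A B f"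
proof
  show "left_proper A B f \<and> right_proper A B f" if "proper_image A B f"
    using that free_sg_singleton
    unfolding proper_image_def left_proper_def right_proper_def by metis
next
  assume "left_proper A B f \<and> right_proper A B f"
  then obtain b c where "b \<in> B" "c \<in> B" "\<And>a. a \<in> A \<Longrightarrow> hd (f [a]) = b \<and> last (f [a]) = c"
    unfolding left_proper_def right_proper_def by blast
  then show "proper_image A B f"
    using free_hom_hd(1)[OF assms] free_hom_last[OF assms] free_sg_hd free_sg_last
    unfolding proper_image_def by metis
qed

text \<open>A left-zero semigroup records the first letter of a word and a right-zero semigroup the
  last one; \<open>\<pi>\<close> and \<open>h\<close> cover both cases at once. The injection
  \<open>g\<close> codes letters by numbers, as members of \<open>V\<close> have carriers of
  numbers.\<close>

lemma zero_sg_quot: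
  fixes A :: "'a set" and \<pi> :: "nat \<Rightarrow> nat \<Rightarrow> nat" and h :: "'a list \<Rightarrow> 'a"
  assumes V: "LSl \<subseteq> V" and A: "finite A" "A \<noteq> {}"
    and \<pi>: "\<pi> = (\<lambda>x y. x) \<and> h = hd \<or> \<pi> = (\<lambda>x y. y) \<and> h = last"
  obtains i g where "i \<in> quots V A" "mul (fst i) = \<pi>" "inj_on g A"
    "\<And>w. w \<in> carrier (free_sg A) \<Longrightarrow> snd i w = g (h w)"
proof -
  obtain g :: "'a \<Rightarrow> nat" where g: "inj_on g A"
    using finite_imp_inj_to_nat_seg[OF A(1)] by blast
  define S where "S = \<lparr>carrier = g ` A, mul = \<pi>\<rparr>"
  \<comment> \<open>In both cases \<open>e s e = e\<close>, so every local subsemigroup is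
    trivial.\<close>
  have "S \<in> LSl"
    using A \<pi> by (auto simp: LSl_def S_def is_semigroup_def)
  have hA: "h w \<in> A" if "w \<in> carrier (free_sg A)" for w
    using \<pi> free_sg_hd[OF that] free_sg_last[OF that] by auto
  have h1: "h [a] = a" for a using \<pi> by auto
  have "(g \<circ> h) ` carrier (free_sg A) = g ` A"
  proof
    show "g ` A \<subseteq> (g \<circ> h) ` carrier (free_sg A)"
    proof
      fix y assume "y \<in> g ` A"
      then obtain a where "a \<in> A" "y = g a" by blast
      then show "y \<in> (g \<circ> h) ` carrier (free_sg A)"
        by (intro image_eqI[of _ _ "[a]"] free_sg_singleton) (simp_all add: h1)
    qed
  qed (use hA in auto)
  moreover have "g (h (u @ v)) = \<pi> (g (h u)) (g (h v))"
    if "u \<in> carrier (free_sg A)" "v \<in> carrier (free_sg A)" for u v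
    using \<pi> that by (auto simp: free_sg_def)
  then have "g \<circ> h \<in> sg_hom (free_sg A) S"
    using hA unfolding sg_hom_free by (simp add: S_def)
  ultimately have "(S, g \<circ> h) \<in> quots V A"
    using \<open>S \<in> LSl\<close> V by (auto simp: quots_def S_def)
  then show ?thesis by (rule that) (simp_all add: S_def g)
qed

section \<open>The images of a directive sequence\<close>

locale pro_directive =
  fixes A :: "nat \<Rightarrow> 'a set" and \<sigma> :: "nat \<Rightarrow> 'a list \<Rightarrow> 'a list" and V :: "nat sgrp set"
  assumes directive: "directive_seq A \<sigma>" and pv: "pseudovariety V"
begin

abbreviation W :: "nat \<Rightarrow> 'a list set" where "W n \<equiv> carrier (free_sg (A n))"
abbreviation F :: "nat \<Rightarrow> ('a quot \<Rightarrow> nat) set" where "F n \<equiv> carrier (free_pro V (A n))"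
abbreviation s :: "nat \<Rightarrow> nat \<Rightarrow> 'a list \<Rightarrow> 'a list" where "s n m \<equiv> sig_comp \<sigma> n m"
abbreviation f :: "nat \<Rightarrow> nat \<Rightarrow> ('a quot \<Rightarrow> nat) \<Rightarrow> 'a quot \<Rightarrow> nat"
  where "f n m \<equiv> pro_comp V A \<sigma> n m"

text \<open>Level \<open>n\<close> of the image system, indexed by absolute levels instead of by
  shifted sequences; \<open>pro_Im_shift\<close> identifies the two.\<close>

definition Img :: "nat \<Rightarrow> ('a quot \<Rightarrow> nat) set" where
  "Img n = (\<Inter>m\<in>{n..}. f n m ` F m)"

lemma A_finite: "finite (A n)" and A_ne: "A n \<noteq> {}"
  using directive by (simp_all add: directive_seq_def)

lemma W_ne: "W n \<noteq> {}"
proof -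
  obtain a where "a \<in> A n" using A_ne[of n] by blast
  then have "[a] \<in> W n" by (rule free_sg_singleton)
  then show ?thesis by (metis empty_iff)
qed

lemma s_hom: "n \<le> m \<Longrightarrow> s n m \<in> sg_hom (free_sg (A m)) (free_sg (A n))"
proof (induction m rule: dec_induct)
  case base
  show ?case by (simp add: sg_hom_def)
next
  case (step m)
  have "s n (Suc m) = s n m \<circ> \<sigma> m"
    using sig_comp_trans[of n m "Suc m" \<sigma>] step.hyps(1) by (simp add: sig_comp_def)
  moreover have "\<sigma> m \<in> sg_hom (free_sg (A (Suc m))) (free_sg (A m))"
    using directive by (simp add: directive_seq_def)
  ultimately show ?case using step.IH sg_hom_comp by metis
qed

lemma s_trans: "n \<le> m \<Longrightarrow> m \<le> p \<Longrightarrow> s n m (s m p w) = s n p w"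
  using sig_comp_trans[of n m p \<sigma>] by (auto simp: fun_eq_iff)

lemma s_closed: "n \<le> m \<Longrightarrow> w \<in> W m \<Longrightarrow> s n m w \<in> W n"
  using free_hom_closed[OF s_hom] .

lemma f_eq: "n \<le> m \<Longrightarrow>
    f n m = (\<lambda>x\<in>F m. \<lambda>i\<in>quots V (A n). x (pull_quot (A m) (s n m) i))"
  unfolding pro_comp_def by (rule pro_ext_eq[OF pv A_ne s_hom])

lemma f_is_pro_ext: "n \<le> m \<Longrightarrow> is_pro_ext V (A m) (A n) (s n m) (f n m)"
  unfolding pro_comp_def by (rule pro_ext_is_pro_ext[OF pv A_ne s_hom])

lemma f_closed: "n \<le> m \<Longrightarrow> x \<in> F m \<Longrightarrow> f n m x \<in> F n"
  using f_is_pro_ext[of n m] by (auto simp: is_pro_ext_def sg_hom_def)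

lemma f_mul: "n \<le> m \<Longrightarrow> x \<in> F m \<Longrightarrow> y \<in> F m \<Longrightarrow>
    f n m (mul (free_pro V (A m)) x y) = mul (free_pro V (A n)) (f n m x) (f n m y)"
  using f_is_pro_ext[of n m] by (auto simp: is_pro_ext_def sg_hom_def)

lemma f_cont: "n \<le> m \<Longrightarrow> continuous_map (topo (free_pro V (A m))) (topo (free_pro V (A n))) (f n m)"
  using f_is_pro_ext[of n m] by (auto simp: is_pro_ext_def)

lemma f_word: "n \<le> m \<Longrightarrow> w \<in> W m \<Longrightarrow> f n m (word_emb V (A m) w) = word_emb V (A n) (s n m w)"
  using f_is_pro_ext[of n m] by (auto simp: is_pro_ext_def)

lemma f_refl:
  assumes "x \<in> F n"
  shows "f n n x = x"
proof -
  have "x \<in> extensional (quots V (A n))"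
    using assms unfolding free_pro_carrier PiE_iff by blast
  then show ?thesis
    using assms by (simp add: f_eq fun_eq_iff pull_quot_id extensional_def)
qed

text \<open>Both sides read the same coordinate of \<open>x\<close>, since pulling a quotient back
  twice is pulling it back along the composite.\<close>

lemma f_trans:
  assumes nm: "n \<le> m" and mp: "m \<le> p" and x: "x \<in> F p"
  shows "f n m (f m p x) = f n p x"
proof
  fix i
  show "f n m (f m p x) i = f n p x i"
  proof (cases "i \<in> quots V (A n)")
    case True
    have "f n m (f m p x) i = f m p x (pull_quot (A m) (s n m) i)"
      using True f_closed[OF mp x] f_eq[OF nm] by simp
    also have "\<dots> = x (pull_quot (A p) (s m p) (pull_quot (A m) (s n m) i))"
      using pull_quot_mem[OF pv A_ne s_hom[OF nm] True] x f_eq[OF mp] by simp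
    also have "\<dots> = x (pull_quot (A p) (s n p) i)"
      by (simp add: pull_quot_comp sig_comp_trans[OF nm mp])
    also have "\<dots> = f n p x i"
      using True x f_eq[of n p] nm mp by simp
    finally show ?thesis .
  next
    case False
    then show ?thesis using f_closed[OF mp x] x f_eq[OF nm] f_eq[of n p] nm mp by simp
  qed
qed

text \<open>This coordinate is the one of \<open>x\<close> at the pulled-back quotient, whose
  carrier consists of the values on words of level \<open>m\<close>.\<close>

lemma f_coord:
  assumes nm: "n \<le> m" and x: "x \<in> F m" and i: "i \<in> quots V (A n)"
  shows "f n m x i \<in> (snd i \<circ> s n m) ` W m"
  using free_pro_at[OF x pull_quot_mem[OF pv A_ne s_hom[OF nm] i]] x i
  by (simp add: f_eq[OF nm] pull_quot_def)

section \<open>Compactness arguments for the images\<close>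

lemma f_image_closedin:
  assumes "n \<le> m"
  shows "closedin (topo (free_pro V (A n))) (f n m ` F m)"
proof -
  have "compactin (topo (free_pro V (A m))) (F m)"
    using free_pro_compact_space[OF pv, of "A m"] by (simp add: compact_space_def free_pro_topspace)
  from image_compactin[OF this f_cont[OF assms]] show ?thesis
    by (rule compactin_imp_closedin[OF free_pro_Hausdorff])
qed

lemma f_image_anti:
  assumes "n \<le> m" "m \<le> p"
  shows "f n p ` F p \<subseteq> f n m ` F m"
proof
  fix x assume "x \<in> f n p ` F p"
  then obtain y where "y \<in> F p" "x = f n p y" by blast
  then show "x \<in> f n m ` F m"
    using f_trans[OF assms, of y] f_closed[OF assms(2), of y] by force
qed

text \<open>Cantor's intersection theorem in a compact space, with the family reindexed to start at
  \<open>n\<close>.\<close>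

lemma nested_closed:
  fixes n :: nat
  assumes "\<And>m. n \<le> m \<Longrightarrow> closedin (topo (free_pro V (A k))) (C m)"
    and "\<And>m. n \<le> m \<Longrightarrow> C m \<noteq> {}"
    and "\<And>m p. n \<le> m \<Longrightarrow> m \<le> p \<Longrightarrow> C p \<subseteq> C m"
  shows "\<exists>x. \<forall>m\<ge>n. x \<in> C m"
proof -
  have "(\<Inter>j. C (n + j)) \<noteq> {}"
  proof (rule compact_space_imp_nest[OF free_pro_compact_space[OF pv, of "A k"]])
    show "decseq (\<lambda>j. C (n + j))"
      unfolding decseq_def by (intro allI impI assms(3)) simp_all
  qed (use assms(1,2) in simp_all)
  then obtain x where x: "\<And>j. x \<in> C (n + j)" by blast
  have "x \<in> C m" if "n \<le> m" for m using x[of "m - n"] that by simp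
  then show ?thesis by blast
qed

lemma ImgD: "x \<in> Img n \<Longrightarrow> n \<le> m \<Longrightarrow> \<exists>y\<in>F m. x = f n m y"
  by (auto simp: Img_def)

lemma Img_ne: "Img n \<noteq> {}"
proof -
  have "f n m ` F m \<noteq> {}" for m using W_ne[of m] word_emb_carrier[of _ "A m" V] by blast
  then have "\<exists>x. \<forall>m\<ge>n. x \<in> f n m ` F m"
    by (intro nested_closed[of n n "\<lambda>m. f n m ` F m"] f_image_closedin f_image_anti)
  then show ?thesis by (auto simp: Img_def)
qed

lemma Img_sub: "Img n \<subseteq> F n"
  using f_closed[of n n] by (auto simp: Img_def)

lemma Img_mul:
  assumes "x \<in> Img n" "y \<in> Img n"
  shows "mul (free_pro V (A n)) x y \<in> Img n"
  unfolding Img_def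
proof
  fix m assume m: "m \<in> {n..}"
  obtain u v where "u \<in> F m" "v \<in> F m" "x = f n m u" "y = f n m v"
    using assms[THEN ImgD, of m] m by auto
  then show "mul (free_pro V (A n)) x y \<in> f n m ` F m"
    using f_mul[of n m u v] m free_pro_mul_closed[OF pv, of u "A m" v]
    by (intro rev_image_eqI[of "mul (free_pro V (A m)) u v"]) auto
qed

lemma f_Img:
  assumes nm: "n \<le> m" and x: "x \<in> Img m"
  shows "f n m x \<in> Img n"
  unfolding Img_def
proof
  fix p assume p: "p \<in> {n..}"
  have "x \<in> f m (max m p) ` F (max m p)" using x by (auto simp: Img_def)
  then obtain y where y: "y \<in> F (max m p)" "x = f m (max m p) y" by blast
  have "f n m x = f n (max m p) y" using f_trans[OF nm _ y(1)] y(2) by simp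
  then show "f n m x \<in> f n p ` F p"
    using f_image_anti[of n p "max m p"] y(1) p by auto
qed

text \<open>The closed fibre over \<open>x\<close> meets every image from a level \<open>p\<close>
  above \<open>m\<close>: lift \<open>x\<close> to level \<open>p\<close> and push the lift down to
  \<open>m\<close>. These intersections decrease, so compactness gives a common point.\<close>

lemma Img_onto:
  assumes nm: "n \<le> m" and x: "x \<in> Img n"
  obtains y where "y \<in> Img m" "f n m y = x"
proof -
  define C where "C = (\<lambda>p. f m p ` F p \<inter> {y \<in> F m. f n m y \<in> {x}})"
  have xF: "x \<in> F n" using x Img_sub by blast
  have "closedin (topo (free_pro V (A m)))
      {y \<in> topspace (topo (free_pro V (A m))). f n m y \<in> {x}}"
    by (rule closedin_continuous_map_preimage[OF f_cont[OF nm]])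
       (simp add: closedin_Hausdorff_sing_eq free_pro_Hausdorff free_pro_topspace xF)
  then have cl: "closedin (topo (free_pro V (A m))) (C p)" if "m \<le> p" for p
    unfolding C_def using that f_image_closedin by (intro closedin_Int) (auto simp: free_pro_topspace)
  have ne: "C p \<noteq> {}" if mp: "m \<le> p" for p
  proof -
    obtain z where z: "z \<in> F p" "x = f n p z" using ImgD[OF x, of p] nm mp by auto
    then have "f m p z \<in> C p" using f_trans[OF nm mp] f_closed[OF mp] by (simp add: C_def)
    then show ?thesis by blast
  qed
  have "\<exists>y. \<forall>p\<ge>m. y \<in> C p"
  proof (rule nested_closed[of m m C])
    show "C q \<subseteq> C p" if "m \<le> p" "p \<le> q" for p q
      using f_image_anti[OF that] by (auto simp: C_def)
  qed (use cl ne in auto)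
  then obtain y where y: "\<forall>p\<ge>m. y \<in> C p" by blast
  show ?thesis
    by (rule that[of y]) (use y in \<open>auto simp: Img_def C_def\<close>)
qed

text \<open>If every level had a word with value outside \<open>Z\<close>, the corresponding closed
  parts of the images would be nonempty and nested, and a common point would be an element of
  \<open>Img n\<close> violating \<open>Z\<close>.\<close>

lemma Img_coord_eventually:
  assumes i: "i \<in> quots V (A n)" and Z: "\<And>x. x \<in> Img n \<Longrightarrow> x i \<in> Z"
  shows "\<exists>m\<ge>n. \<forall>w\<in>W m. snd i (s n m w) \<in> Z"
proof (rule ccontr)
  assume not_thesis: "\<not> (\<exists>m\<ge>n. \<forall>w\<in>W m. snd i (s n m w) \<in> Z)"
  have bad: "\<exists>w\<in>W m. snd i (s n m w) \<notin> Z" if nm: "n \<le> m" for m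
    using not_thesis nm by blast
  define C where "C = (\<lambda>m. f n m ` F m \<inter> {x \<in> F n. x i \<in> - Z})"
  have ne: "C m \<noteq> {}" if nm: "n \<le> m" for m
  proof -
    obtain w where w: "w \<in> W m" "snd i (s n m w) \<notin> Z" using bad[OF nm] by blast
    have "f n m (word_emb V (A m) w) i \<notin> Z"
      using w i by (simp only: f_word[OF nm w(1)]) (simp add: word_emb_def)
    then show ?thesis
      using word_emb_carrier[OF w(1), of V] f_closed[OF nm] by (auto simp: C_def)
  qed
  have "\<exists>x. \<forall>m\<ge>n. x \<in> C m"
  proof (rule nested_closed[of n n C])
    show "C q \<subseteq> C p" if "n \<le> p" "p \<le> q" for p q
      using f_image_anti[OF that] by (auto simp: C_def)
    show "closedin (topo (free_pro V (A n))) (C m)" if "n \<le> m" for m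
      unfolding C_def by (intro closedin_Int f_image_closedin that free_pro_closedin_at i)
  qed (use ne in auto)
  then obtain x where "\<forall>m\<ge>n. x \<in> C m" by blast
  then have "x \<in> Img n" "x i \<notin> Z" by (auto simp: Img_def C_def)
  then show False using Z by blast
qed

text \<open>Convergence in a product of discrete spaces is eventual constancy in each coordinate,
  and \<open>Img n\<close> is closed even in the full product. Thus \<open>l\<close> need not be
  known to satisfy the compatibility conditions beforehand.\<close>

lemma Img_limit:
  assumes X: "\<And>k. X k \<in> Img n" and l: "l \<in> extensional (quots V (A n))"
    and ev: "\<And>i. i \<in> quots V (A n) \<Longrightarrow> eventually (\<lambda>k. X k i = l i) sequentially"
  shows "l \<in> Img n"
proof -
  let ?P = "product_topology (\<lambda>i. discrete_topology (carrier (fst i))) (quots V (A n))"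
  have "closedin ?P (f n m ` F m)" if "n \<le> m" for m
    using f_image_closedin[OF that] unfolding free_pro_topo
    by (rule closedin_trans_full[OF _ free_pro_closedin])
  then have cl: "closedin ?P (Img n)"
    unfolding Img_def by (rule closedin_INT[rotated]) simp_all
  have "limitin (discrete_topology (carrier (fst i))) (\<lambda>k. X k i) (l i) sequentially"
    if i: "i \<in> quots V (A n)" for i
  proof -
    obtain k where k: "X k i = l i"
      using eventually_happens[OF ev[OF i]] trivial_limit_sequentially by blast
    have "X k \<in> F n" using X Img_sub by blast
    from free_pro_at[OF this i] k have "l i \<in> carrier (fst i)" by simp
    then show ?thesis
      unfolding limitin_def topspace_discrete_topology
      by (intro conjI allI impI eventually_mono[OF ev[OF i]]) simp_all
  qed
  moreover have "X k \<in> topspace ?P" for k using X closedin_subset[OF cl] by blast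
  ultimately have "limitin ?P X l sequentially"
    unfolding limitin_componentwise using l by simp
  then show ?thesis
    by (rule limitin_closedin[OF _ cl]) (simp_all add: X)
qed

section \<open>The images as topological semigroups\<close>

abbreviation PI :: "nat \<Rightarrow> ('a quot \<Rightarrow> nat) top_sgrp" where
  "PI n \<equiv> top_subsg (free_pro V (A n)) (Img n)"

lemma pro_Im_shift: "pro_Im V (seq_shift n A) (seq_shift n \<sigma>) = PI n"
proof -
  have "(\<Inter>m. f n (m + n) ` F (m + n)) = Img n"
    unfolding Img_def
  proof (intro subset_antisym subsetI INT_I)
    fix x m assume x: "x \<in> (\<Inter>m. f n (m + n) ` F (m + n))" and "m \<in> {n..}"
    then show "x \<in> f n m ` F m" using INT_D[OF x UNIV_I, of "m - n"] by simp
  qed auto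
  then show ?thesis
    by (simp add: pro_Im_def pro_comp_def sig_comp_shift) (simp add: seq_shift_def)
qed

lemma PI_carrier: "carrier (PI n) = Img n" and PI_mul: "mul (PI n) = mul (free_pro V (A n))"
  by (simp_all add: top_subsg_def)

section \<open>Properness along compositions\<close>

text \<open>Precomposition only restricts the words considered; postcomposition replaces
  \<open>b\<close> and \<open>c\<close> by the first letter of the image of \<open>b\<close> and the
  last letter of the image of \<open>c\<close>.\<close>

lemma proper_image_mono:
  assumes "k \<le> n" "n \<le> m" "m \<le> p" "proper_image (A m) (A n) (s n m)"
  shows "proper_image (A p) (A k) (s k p)"
proof -
  obtain b c where bc: "b \<in> A n" "c \<in> A n"
    "\<And>w. w \<in> W m \<Longrightarrow> hd (s n m w) = b \<and> last (s n m w) = c"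
    using assms(4) unfolding proper_image_def by blast
  have "hd (s k p w) = hd (s k n [b]) \<and> last (s k p w) = last (s k n [c])" if w: "w \<in> W p" for w
  proof -
    define v where "v = s n m (s m p w)"
    have v: "v \<in> W n" "hd v = b" "last v = c"
      using bc(3) s_closed w assms(2,3) by (simp_all add: v_def)
    have "s k p w = s k n v"
      using s_trans assms(1-3) by (simp add: v_def)
    then show ?thesis
      using v free_hom_hd(1)[OF s_hom[OF assms(1)]] free_hom_last[OF s_hom[OF assms(1)]] by simp
  qed
  moreover have "s k n [b] \<in> W k" "s k n [c] \<in> W k"
    using bc(1,2) s_closed[OF assms(1)] free_sg_singleton by metis+
  ultimately show ?thesis
    using free_sg_hd free_sg_last unfolding proper_image_def by metis
qed

text \<open>Forwards, \<open>n \<le> r n\<close> puts a proper block of the contraction above level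
  \<open>n\<close>. Backwards, iterating a choice function \<open>t\<close> from 0 yields the
  contraction.\<close>

lemma has_proper_contraction_iff:
  "has_proper_contraction A \<sigma> \<longleftrightarrow> (\<forall>n. \<exists>m>n. proper_image (A m) (A n) (s n m))"
proof
  assume "has_proper_contraction A \<sigma>"
  then obtain r where r: "strict_mono r"
    "proper_seq (\<lambda>k. A (r k)) (\<lambda>k. sig_comp \<sigma> (r k) (r (Suc k)))"
    unfolding has_proper_contraction_def by blast
  show "\<forall>n. \<exists>m>n. proper_image (A m) (A n) (s n m)"
  proof
    fix n
    have nr: "n \<le> r n" "r n < r (Suc n)"
      using r(1) by (simp_all add: strict_mono_imp_increasing strict_mono_Suc_iff)
    have "proper_image (A (r (Suc n))) (A (r n)) (s (r n) (r (Suc n)))"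
      using r(2) nr(2) s_hom[of "r n" "r (Suc n)"] by (simp add: proper_image_iff proper_seq_def)
    then show "\<exists>m>n. proper_image (A m) (A n) (s n m)"
      using proper_image_mono[OF nr(1) _ order_refl] nr by (intro exI[of _ "r (Suc n)"]) simp
  qed
next
  assume "\<forall>n. \<exists>m>n. proper_image (A m) (A n) (s n m)"
  then obtain t where t: "\<And>n. n < t n" "\<And>n. proper_image (A (t n)) (A n) (s n (t n))"
    by metis
  define r where "r = (\<lambda>k. (t ^^ k) 0)"
  have r: "r 0 = 0" "\<And>k. r (Suc k) = t (r k)" by (simp_all add: r_def)
  have "strict_mono r" using t(1) r by (simp add: strict_mono_Suc_iff)
  moreover have "proper_seq (\<lambda>k. A (r k)) (\<lambda>k. sig_comp \<sigma> (r k) (r (Suc k)))"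
    unfolding proper_seq_def
  proof
    fix k
    show "left_proper (A (r (Suc k))) (A (r k)) (s (r k) (r (Suc k)))
        \<and> right_proper (A (r (Suc k))) (A (r k)) (s (r k) (r (Suc k)))"
      using t[of "r k"] s_hom[of "r k" "t (r k)"] by (simp add: r proper_image_iff)
  qed
  ultimately show "has_proper_contraction A \<sigma>"
    using r(1) unfolding has_proper_contraction_def by blast
qed

section \<open>From groups to properness\<close>

text \<open>In a left-zero coordinate \<open>x = e x\<close> forces \<open>x i = e i\<close>, and in
  a right-zero one \<open>x = x e\<close> does. So this coordinate is constant on
  \<open>Img n\<close>, and by compactness already on words of some level.\<close>

lemma group_imp_constant:
  fixes \<pi> :: "nat \<Rightarrow> nat \<Rightarrow> nat" and h :: "'a list \<Rightarrow> 'a"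
  assumes LSl: "LSl \<subseteq> V" and G: "is_group (PI n)"
    and \<pi>: "\<pi> = (\<lambda>x y. x) \<and> h = hd \<or> \<pi> = (\<lambda>x y. y) \<and> h = last"
  shows "\<exists>m\<ge>n. \<exists>b\<in>A n. \<forall>w\<in>W m. h (s n m w) = b"
proof -
  obtain i g where i: "i \<in> quots V (A n)" and mi: "mul (fst i) = \<pi>" and g: "inj_on g (A n)"
    and ig: "\<And>w. w \<in> W n \<Longrightarrow> snd i w = g (h w)"
    by (rule zero_sg_quot[OF LSl A_finite A_ne \<pi>]) (rule that)
  obtain e where e: "e \<in> Img n" "\<And>x. x \<in> Img n \<Longrightarrow> mul (free_pro V (A n)) e x = x"
    "\<And>x. x \<in> Img n \<Longrightarrow> mul (free_pro V (A n)) x e = x"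
    using is_groupE[OF G] unfolding PI_carrier PI_mul by metis
  have "x i = e i" if x: "x \<in> Img n" for x
  proof -
    have "x i = \<pi> (e i) (x i)" "x i = \<pi> (x i) (e i)"
      using fun_cong[OF e(2)[OF x], of i] fun_cong[OF e(3)[OF x], of i] i mi
      by (simp_all add: free_pro_mul)
    then show ?thesis using \<pi> by auto
  qed
  then obtain m where m: "n \<le> m" "\<And>w. w \<in> W m \<Longrightarrow> snd i (s n m w) = e i"
    using Img_coord_eventually[OF i, of "{e i}"] by auto
  have hA: "h (s n m w) \<in> A n" if "w \<in> W m" for w
    using \<pi> s_closed[OF m(1) that] free_sg_hd free_sg_last by metis
  obtain w0 where w0: "w0 \<in> W m" using W_ne by blast
  have "h (s n m w) = h (s n m w0)" if w: "w \<in> W m" for w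
    using m ig s_closed w w0 hA by (intro inj_onD[OF g]) metis+
  then show ?thesis using m(1) hA[OF w0] by blast
qed

lemma group_imp_proper_image:
  assumes LSl: "LSl \<subseteq> V" and G: "is_group (PI n)"
  shows "\<exists>m>n. proper_image (A m) (A n) (s n m)"
proof -
  obtain m1 b where m1: "n \<le> m1" "b \<in> A n" "\<And>w. w \<in> W m1 \<Longrightarrow> hd (s n m1 w) = b"
    using group_imp_constant[OF LSl G, of "\<lambda>x y. x" hd] by auto
  obtain m2 c where m2: "n \<le> m2" "c \<in> A n" "\<And>w. w \<in> W m2 \<Longrightarrow> last (s n m2 w) = c"
    using group_imp_constant[OF LSl G, of "\<lambda>x y. y" last] by auto
  \<comment> \<open>The successor ensures \<open>n < m\<close> even if both levels found equal
    \<open>n\<close>.\<close>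
  define m where "m = Suc (max m1 m2)"
  have m: "n < m" "m1 \<le> m" "m2 \<le> m" using m1(1) by (simp_all add: m_def)
  have "hd (s n m w) = b \<and> last (s n m w) = c" if w: "w \<in> W m" for w
    using m1 m2 m w s_trans[of n _ m w] s_closed[of _ m w] by metis
  then show ?thesis using m(1) m1(2) m2(2) unfolding proper_image_def by blast
qed

section \<open>From properness to groups\<close>

text \<open>The value sets are finite and decreasing, so they are constant from a level of minimal
  cardinality on.\<close>

lemma coord_stable:
  assumes i: "i \<in> quots V (A n)"
  obtains k where "n \<le> k" "\<And>m. k \<le> m \<Longrightarrow> (snd i \<circ> s n m) ` W m = (snd i \<circ> s n k) ` W k"
proof -
  define R where "R = (\<lambda>m. (snd i \<circ> s n m) ` W m)"
  have fin: "finite (R m)" if nm: "n \<le> m" for m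
  proof (rule finite_subset)
    show "R m \<subseteq> carrier (fst i)"
      using quot_hom[OF i] s_closed[OF nm] by (auto simp: R_def sg_hom_free)
    show "finite (carrier (fst i))" using pv_finite[OF pv quot_mem[OF i]] .
  qed
  have anti: "R p \<subseteq> R m" if nm: "n \<le> m" "m \<le> p" for m p
  proof
    fix x assume "x \<in> R p"
    then obtain w where "w \<in> W p" "x = snd i (s n p w)" by (auto simp: R_def)
    then have "x = (snd i \<circ> s n m) (s m p w)" "s m p w \<in> W m"
      using s_trans[OF nm] s_closed[OF nm(2)] by simp_all
    then show "x \<in> R m" unfolding R_def by (rule image_eqI)
  qed
  obtain k where k: "n \<le> k" "\<And>m. n \<le> m \<Longrightarrow> card (R k) \<le> card (R m)"
    using ex_has_least_nat[of "\<lambda>m. n \<le> m" n "card \<circ> R"] by auto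
  have "R m = R k" if "k \<le> m" for m
    using card_seteq[OF fin[OF k(1)] anti[OF k(1) that]] k that by simp
  from that[OF k(1) this[unfolded R_def]] show ?thesis .
qed

text \<open>At a stable level \<open>k\<close>, each value is attained by the image of a word from a
  higher level \<open>m\<close>. Such an image has fixed end letters and contains all letters of
  \<open>A k\<close>, as \<open>finite_image_is_group\<close> demands.\<close>

lemma coord_group:
  assumes prim: "primitive_seq A \<sigma>" and proper: "\<And>n. \<exists>m>n. proper_image (A m) (A n) (s n m)"
    and i: "i \<in> quots V (A n)"
  shows "\<exists>T. finite T \<and> is_group (\<lparr>carrier = T, mul = mul (fst i)\<rparr> :: nat sgrp) \<and> (\<forall>x\<in>Img n. x i \<in> T)"
proof -
  obtain k where k: "n \<le> k" "\<And>m. k \<le> m \<Longrightarrow> (snd i \<circ> s n m) ` W m = (snd i \<circ> s n k) ` W k"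
    using coord_stable[OF i] by blast
  define p where "p = snd i \<circ> s n k"
  obtain m1 m2 where m12: "k < m1" "proper_image (A m1) (A k) (s k m1)"
      "k < m2" "positive_hom (A m2) (A k) (s k m2)"
    using proper prim unfolding primitive_seq_def by metis
  define m where "m = max m1 m2"
  have m: "k \<le> m" "m2 \<le> m" "m1 \<le> m" using m12 by (auto simp: m_def)
  obtain b c where bc: "b \<in> A k" "c \<in> A k"
    "\<And>w. w \<in> W m \<Longrightarrow> hd (s k m w) = b \<and> last (s k m w) = c"
    using proper_image_mono[OF order_refl _ m(3) m12(2)] m12(1)
    unfolding proper_image_def by auto
  \<comment> \<open>Positivity concerns single letters; it reaches words because the image of the
    first letter is a prefix.\<close>
  have pos: "A k \<subseteq> set (s k m w) \<and> 2 \<le> length (s k m w)" if w: "w \<in> W m" for w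
  proof -
    define v where "v = s m2 m w"
    have v: "v \<in> W m2" "s k m w = s k m2 v"
      using s_closed[OF m(2) w] s_trans m(2) m12(3) by (simp_all add: v_def)
    have "A k \<subseteq> set (s k m2 [hd v])" "2 \<le> length (s k m2 [hd v])"
      using m12(4) free_sg_hd[OF v(1)] by (auto simp: positive_hom_def)
    then show ?thesis
      using free_hom_hd(2,3)[OF s_hom v(1), of k] m12(3) v(2) by auto
  qed
  have p: "p \<in> sg_hom (free_sg (A k)) (fst i)"
    unfolding p_def by (rule sg_hom_comp[OF quot_hom[OF i] s_hom[OF k(1)]])
  have "p ` W k \<subseteq> carrier (fst i)" using p by (auto simp: sg_hom_free)
  then have fin: "finite (p ` W k)"
    by (rule finite_subset) (rule pv_finite[OF pv quot_mem[OF i]])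
  have pk: "p ` W k = (snd i \<circ> s n m) ` W m" using k(2)[OF m(1)] by (simp add: p_def)
  have "is_group (\<lparr>carrier = p ` W k, mul = mul (fst i)\<rparr> :: nat sgrp)"
  proof (rule finite_image_is_group[OF pv_sg[OF pv quot_mem[OF i]] p _ bc(1,2)])
    show "finite (p ` W k)" by (rule fin)
    fix x assume "x \<in> p ` W k"
    then obtain w where w: "w \<in> W m" "x = snd i (s n m w)" unfolding pk by auto
    then show "\<exists>w\<in>W k. p w = x \<and> hd w = b \<and> last w = c \<and> A k \<subseteq> set w \<and> 2 \<le> length w"
      using bc(3) pos s_closed[OF m(1)] s_trans[OF k(1) m(1)]
      by (intro bexI[of _ "s k m w"]) (simp_all add: p_def)
  qed
  moreover have "x i \<in> p ` W k" if x: "x \<in> Img n" for x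
    using ImgD[OF x k(1)] f_coord[OF k(1) _ i] unfolding p_def by blast
  ultimately show ?thesis using fin by blast
qed

text \<open>Multiplication is coordinatewise in the finite groups \<open>T i\<close>; closedness is
  needed to know that the coordinatewise unit and inverses belong to \<open>Img n\<close>.\<close>

lemma PI_group:
  assumes prim: "primitive_seq A \<sigma>" and proper: "\<And>n. \<exists>m>n. proper_image (A m) (A n) (s n m)"
  shows "is_group (PI n)"
proof -
  let ?Q = "quots V (A n)" and ?M = "mul (free_pro V (A n))"
  have "\<forall>i\<in>?Q. \<exists>T. finite T \<and> is_group (\<lparr>carrier = T, mul = mul (fst i)\<rparr> :: nat sgrp)
      \<and> (\<forall>x\<in>Img n. x i \<in> T)"
    using coord_group[OF prim proper] by (rule ballI)
  from bchoice[OF this] obtain T where T': "\<forall>i\<in>?Q. finite (T i)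
      \<and> is_group (\<lparr>carrier = T i, mul = mul (fst i)\<rparr> :: nat sgrp) \<and> (\<forall>x\<in>Img n. x i \<in> T i)"
    by (rule exE)
  have T: "finite (T i)" "is_group (\<lparr>carrier = T i, mul = mul (fst i)\<rparr> :: nat sgrp)"
    "\<forall>x\<in>Img n. x i \<in> T i" if "i \<in> ?Q" for i
    using bspec[OF T' that, THEN conjunct1] bspec[OF T' that, THEN conjunct2, THEN conjunct1]
      bspec[OF T' that, THEN conjunct2, THEN conjunct2] .
  have "\<exists>u. group \<lparr>carrier = T i, monoid.mult = mul (fst i), one = u\<rparr>" if "i \<in> ?Q" for i
    using T(2)[OF that] by (simp add: is_group_def)
  then obtain u where u: "\<forall>i\<in>?Q. group \<lparr>carrier = T i, monoid.mult = mul (fst i), one = u i\<rparr>"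
    using bchoice[of ?Q "\<lambda>i u. group \<lparr>carrier = T i, monoid.mult = mul (fst i), one = u\<rparr>"] by blast
  define G where "G = (\<lambda>i. \<lparr>carrier = T i, monoid.mult = mul (fst i), one = u i\<rparr>)"
  have G: "group (G i)" if "i \<in> ?Q" for i using bspec[OF u that] by (simp add: G_def)
  have GT: "x i \<in> carrier (G i)" if "i \<in> ?Q" "x \<in> Img n" for i x
    using bspec[OF T(3)[OF that(1)] that(2)] by (simp add: G_def)
  have Mi: "?M x y i = x i \<otimes>\<^bsub>G i\<^esub> y i" if "i \<in> ?Q" for x y i
    using that by (simp add: free_pro_mul G_def)
  \<comment> \<open>A semigroup has no empty power, so \<open>pw x k\<close> is the power of
    \<open>x\<close> with exponent \<open>k + 1\<close>.\<close>
  define pw where "pw = (\<lambda>x k. (?M x ^^ k) x)"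
  have pw_Img: "pw x k \<in> Img n" if x: "x \<in> Img n" for x k
    by (induction k) (simp_all add: pw_def x Img_mul)
  have pw_at: "pw x k i = x i [^]\<^bsub>G i\<^esub> Suc k" if i: "i \<in> ?Q" and x: "x \<in> Img n" for x k i
  proof (induction k)
    case 0
    show ?case using GT[OF i x] G[OF i] by (simp add: pw_def group.is_monoid monoid.nat_pow_eone)
  next
    case (Suc k)
    have "pw x (Suc k) i = x i \<otimes>\<^bsub>G i\<^esub> pw x k i" by (simp add: pw_def Mi[OF i])
    then show ?case
      using Suc GT[OF i x] G[OF i] by (simp only: monoid.nat_pow_Suc2 group.is_monoid)
  qed
  \<comment> \<open>For \<open>k\<close> at least the order of the group, that order divides
    \<open>k!\<close>. One sequence of exponents therefore serves all coordinates.\<close>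
  have pw1: "eventually (\<lambda>k. x i [^]\<^bsub>G i\<^esub> (fact k :: nat) = \<one>\<^bsub>G i\<^esub>) sequentially"
    if i: "i \<in> ?Q" and x: "x \<in> Img n" for x i
  proof (rule eventually_sequentiallyI[of "order (G i)"])
    interpret group "G i" by (rule G[OF i])
    have "finite (carrier (G i))" using T(1)[OF i] by (simp add: G_def)
    then have "1 \<le> order (G i)" using order_gt_0_iff_finite by simp
    fix k assume "order (G i) \<le> k"
    then obtain d where "fact k = order (G i) * d"
      using dvd_fact[OF \<open>1 \<le> order (G i)\<close>] by (metis dvdE)
    then show "x i [^]\<^bsub>G i\<^esub> (fact k :: nat) = \<one>\<^bsub>G i\<^esub>"
      using GT[OF i x] pow_order_eq_1 by (metis nat_pow_pow nat_pow_one)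
  qed
  define e where "e = (\<lambda>i\<in>?Q. \<one>\<^bsub>G i\<^esub>)"
  have e_Img: "e \<in> Img n"
  proof -
    obtain x where x: "x \<in> Img n" using Img_ne by blast
    show ?thesis
    proof (rule Img_limit)
      \<comment> \<open>By the shift in \<open>pw\<close>, this is the power with exponent
        \<open>k!\<close>.\<close>
      show "pw x (fact k - 1) \<in> Img n" for k by (rule pw_Img[OF x])
      show "e \<in> extensional ?Q" by (simp add: e_def)
      show "eventually (\<lambda>k. pw x (fact k - 1) i = e i) sequentially" if i: "i \<in> ?Q" for i
        using pw1[OF i x] by (rule eventually_mono) (simp add: pw_at[OF i x] e_def i)
    qed
  qed
  have inv_Img: "(\<lambda>i\<in>?Q. inv\<^bsub>G i\<^esub> x i) \<in> Img n" if x: "x \<in> Img n" for x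
  proof (rule Img_limit)
    \<comment> \<open>The exponent is \<open>2 k! - 1\<close>, which is positive for every
      \<open>k\<close>, whereas \<open>k! - 1\<close> vanishes for \<open>k \<le> 1\<close>.\<close>
    show "pw x (2 * fact k - 2) \<in> Img n" for k by (rule pw_Img[OF x])
    show "eventually (\<lambda>k. pw x (2 * fact k - 2) i = (\<lambda>i\<in>?Q. inv\<^bsub>G i\<^esub> x i) i) sequentially"
      if i: "i \<in> ?Q" for i
      using pw1[OF i x]
    proof (rule eventually_mono)
      interpret group "G i" by (rule G[OF i])
      fix k assume one: "x i [^]\<^bsub>G i\<^esub> (fact k :: nat) = \<one>\<^bsub>G i\<^esub>"
      have "1 \<le> (fact k :: nat)" by (rule fact_ge_1)
      then have k: "Suc (Suc (2 * fact k - 2)) = (fact k + fact k :: nat)" by linarith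
      have "pw x (2 * fact k - 2) i \<otimes>\<^bsub>G i\<^esub> x i = x i [^]\<^bsub>G i\<^esub> Suc (Suc (2 * fact k - 2))"
        by (simp add: pw_at[OF i x])
      also have "\<dots> = \<one>\<^bsub>G i\<^esub>"
        unfolding k using one GT[OF i x] by (simp flip: nat_pow_mult)
      finally have "inv\<^bsub>G i\<^esub> x i = pw x (2 * fact k - 2) i"
        by (rule inv_equality) (simp_all add: GT[OF i] x pw_Img)
      then show "pw x (2 * fact k - 2) i = (\<lambda>i\<in>?Q. inv\<^bsub>G i\<^esub> x i) i" using i by simp
    qed
  qed simp
  have ext: "x = y" if xy: "x \<in> Img n" "y \<in> Img n" and eq: "\<And>i. i \<in> ?Q \<Longrightarrow> x i = y i" for x y
  proof (rule extensionalityI)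
    have "x \<in> F n" "y \<in> F n" using xy Img_sub by blast+
    then show "x \<in> extensional ?Q" "y \<in> extensional ?Q"
      unfolding free_pro_carrier PiE_iff by blast+
  qed (rule eq)
  have "group \<lparr>carrier = Img n, monoid.mult = ?M, one = e\<rparr>"
  proof (rule groupI, unfold partial_object.simps monoid.simps)
    show "?M x y \<in> Img n" if "x \<in> Img n" "y \<in> Img n" for x y using Img_mul[OF that] .
    show "e \<in> Img n" by (rule e_Img)
    show "?M (?M x y) z = ?M x (?M y z)" if "x \<in> Img n" "y \<in> Img n" "z \<in> Img n" for x y z
      using that by (intro ext Img_mul) (simp_all add: Mi GT G group.is_monoid monoid.m_assoc)
    show "?M e x = x" if x: "x \<in> Img n" for x
      using x e_Img
      by (intro ext Img_mul) (simp_all add: Mi GT G e_def group.is_monoid monoid.l_one)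
    show "\<exists>y\<in>Img n. ?M y x = e" if x: "x \<in> Img n" for x
    proof
      show "?M (\<lambda>i\<in>?Q. inv\<^bsub>G i\<^esub> x i) x = e"
        using x e_Img inv_Img[OF x]
        by (intro ext Img_mul) (simp_all add: Mi GT G e_def group.l_inv)
    qed (rule inv_Img[OF x])
  qed
  then show ?thesis unfolding is_group_def PI_carrier PI_mul by blast
qed

section \<open>The inverse limit and its projections\<close>

lemma pro_Im_inf_carrier:
  "x \<in> carrier (pro_Im_inf V A \<sigma>) \<longleftrightarrow>
     (\<forall>n. x n \<in> Img n) \<and> (\<forall>n m. n \<le> m \<longrightarrow> f n m (x m) = x n)"
  unfolding pro_Im_inf_def inv_limit_def Let_def pro_Im_shift PI_carrier by auto

lemma pro_Im_inf_mul:
  "mul (pro_Im_inf V A \<sigma>) x y = (\<lambda>n. mul (free_pro V (A n)) (x n) (y n))"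
  unfolding pro_Im_inf_def inv_limit_def Let_def pro_Im_shift PI_mul by (simp add: fun_eq_iff)

text \<open>Starting from \<open>x\<close>, lift step by step through the levels above
  \<open>n\<close>, then push these lifts down to obtain all levels.\<close>

lemma pro_Im_inf_onto:
  assumes x: "x \<in> Img n"
  obtains z where "z \<in> carrier (pro_Im_inf V A \<sigma>)" "z n = x"
proof -
  have "\<exists>y. y 0 = x \<and> (\<forall>k. y k \<in> Img (n + k)) \<and> (\<forall>k. f (n + k) (n + Suc k) (y (Suc k)) = y k)"
  proof -
    \<comment> \<open>The clause for \<open>k = 0\<close> fixes the start of the dependent choice at
      \<open>x\<close>.\<close>
    have "\<exists>y. \<forall>k. (y k \<in> Img (n + k) \<and> (k = 0 \<longrightarrow> y k = x))
        \<and> f (n + k) (n + Suc k) (y (Suc k)) = y k"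
    proof (rule dependent_nat_choice[where P = "\<lambda>k y. y \<in> Img (n + k) \<and> (k = 0 \<longrightarrow> y = x)"
          and Q = "\<lambda>k y y'. f (n + k) (n + Suc k) y' = y"])
      show "\<exists>y. y \<in> Img (n + 0) \<and> (0 = (0::nat) \<longrightarrow> y = x)" using x by auto
      show "\<exists>y'. (y' \<in> Img (n + Suc k) \<and> (Suc k = 0 \<longrightarrow> y' = x)) \<and> f (n + k) (n + Suc k) y' = y"
        if "y \<in> Img (n + k) \<and> (k = 0 \<longrightarrow> y = x)" for y k
        using Img_onto[of "n + k" "n + Suc k" y] that by auto
    qed
    then show ?thesis by auto
  qed
  then obtain y where y: "y 0 = x" "\<And>k. y k \<in> Img (n + k)"
    "\<And>k. f (n + k) (n + Suc k) (y (Suc k)) = y k" by blast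
  have yF: "y k \<in> F (n + k)" for k using y(2) Img_sub by blast
  have y_le: "f (n + j) (n + k) (y k) = y j" if "j \<le> k" for j k
    using that
  proof (induction k rule: dec_induct)
    case base
    show ?case using f_refl yF by simp
  next
    case (step k)
    then show ?case using f_trans[of "n + j" "n + k" "n + Suc k", OF _ _ yF] y(3)[of k] by simp
  qed
  \<comment> \<open>Since \<open>m \<le> n + m\<close>, one formula covers the levels below
    \<open>n\<close> as well as those above it.\<close>
  define z where "z = (\<lambda>m. f m (n + m) (y m))"
  have "z m \<in> Img m" for m unfolding z_def using f_Img y(2) by simp
  moreover have "f m p (z p) = z m" if mp: "m \<le> p" for m p
  proof -
    have "f m p (z p) = f m (n + p) (y p)"
      unfolding z_def using mp yF by (intro f_trans) simp_all
    also have "\<dots> = f m (n + m) (f (n + m) (n + p) (y p))"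
      using mp yF by (intro f_trans[symmetric]) simp_all
    finally show ?thesis using y_le[OF mp] by (simp add: z_def)
  qed
  ultimately have "z \<in> carrier (pro_Im_inf V A \<sigma>)" by (simp add: pro_Im_inf_carrier)
  moreover have "z n = x" unfolding z_def using y_le[of 0 n] y(1) by simp
  ultimately show ?thesis by (rule that)
qed

lemma PI_group_of_inf:
  assumes "is_group (pro_Im_inf V A \<sigma>)"
  shows "is_group (PI n)"
proof (rule is_group_image[OF assms])
  show "(\<lambda>z. z n) \<in> sg_hom (pro_Im_inf V A \<sigma>) (PI n)"
    by (simp add: sg_hom_def pro_Im_inf_mul PI_carrier PI_mul) (simp add: pro_Im_inf_carrier)
  show "(\<lambda>z. z n) ` carrier (pro_Im_inf V A \<sigma>) = carrier (PI n)"
    unfolding PI_carrier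
  proof
    show "Img n \<subseteq> (\<lambda>z. z n) ` carrier (pro_Im_inf V A \<sigma>)"
    proof
      fix x assume "x \<in> Img n"
      then obtain z where "z \<in> carrier (pro_Im_inf V A \<sigma>)" "z n = x"
        by (rule pro_Im_inf_onto)
      then show "x \<in> (\<lambda>z. z n) ` carrier (pro_Im_inf V A \<sigma>)" by blast
    qed
  qed (auto simp: pro_Im_inf_carrier)
qed

text \<open>The units and inverses chosen at the separate levels are shown to be compatible with the
  connecting maps, hence to be points of the limit.\<close>

lemma inf_group_of_PI:
  assumes G: "\<And>n. is_group (PI n)"
  shows "is_group (pro_Im_inf V A \<sigma>)"
proof -
  let ?M = "\<lambda>n. mul (free_pro V (A n))" and ?I = "carrier (pro_Im_inf V A \<sigma>)"
  have "\<exists>e. e \<in> Img n \<and> (\<forall>x\<in>Img n. ?M n e x = x \<and> ?M n x e = x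
      \<and> (\<exists>y\<in>Img n. ?M n x y = e \<and> ?M n y x = e))" for n
    by (rule is_groupE[OF G[of n]], unfold PI_carrier PI_mul) blast
  then obtain e where e: "\<And>n. e n \<in> Img n" "\<And>n x. x \<in> Img n \<Longrightarrow> ?M n (e n) x = x"
    "\<And>n x. x \<in> Img n \<Longrightarrow> ?M n x (e n) = x"
    and inv: "\<And>n x. x \<in> Img n \<Longrightarrow> \<exists>y\<in>Img n. ?M n x y = e n \<and> ?M n y x = e n"
    by metis
  have as: "?M n (?M n x y) z = ?M n x (?M n y z)"
    if "x \<in> Img n" "y \<in> Img n" "z \<in> Img n" for n x y z
  proof -
    have "is_semigroup (PI n)" using is_groupE[OF G[of n]] by blast
    then show ?thesis using that unfolding is_semigroup_def PI_carrier PI_mul by blast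
  qed
  have fm: "f n m (?M m x y) = ?M n (f n m x) (f n m y)"
    if "n \<le> m" "x \<in> Img m" "y \<in> Img m" for n m x y
    using f_mul[OF that(1)] Img_sub that by blast
  have eI: "e \<in> ?I"
    unfolding pro_Im_inf_carrier
  proof (intro conjI allI impI)
    fix n m :: nat assume nm: "n \<le> m"
    have em: "f n m (e m) \<in> Img n" using f_Img[OF nm e(1)] .
    have "?M n (f n m (e m)) (f n m (e m)) = f n m (e m)"
      using fm[OF nm e(1) e(1)] e(2)[OF e(1)] by simp
    \<comment> \<open>The image of the idempotent \<open>e m\<close> is idempotent, so it is the
      unit of level \<open>n\<close>.\<close>
    from is_group_idem(1)[OF G[of n], unfolded PI_carrier PI_mul, OF em this e(1)]
    show "f n m (e m) = e n" using e(3)[OF em] by simp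
  qed (rule e(1))
  have mulI: "mul (pro_Im_inf V A \<sigma>) x y \<in> ?I" if "x \<in> ?I" "y \<in> ?I" for x y
    using that Img_mul fm by (simp add: pro_Im_inf_carrier pro_Im_inf_mul)
  have "group \<lparr>carrier = ?I, monoid.mult = mul (pro_Im_inf V A \<sigma>), one = e\<rparr>"
  proof (rule groupI, unfold partial_object.simps monoid.simps)
    show "mul (pro_Im_inf V A \<sigma>) (mul (pro_Im_inf V A \<sigma>) x y) z =
        mul (pro_Im_inf V A \<sigma>) x (mul (pro_Im_inf V A \<sigma>) y z)"
      if "x \<in> ?I" "y \<in> ?I" "z \<in> ?I" for x y z
      using that as by (simp add: pro_Im_inf_carrier pro_Im_inf_mul)
    show "mul (pro_Im_inf V A \<sigma>) e x = x" if "x \<in> ?I" for x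
      using that e(2) by (simp add: pro_Im_inf_carrier pro_Im_inf_mul)
    show "\<exists>y\<in>?I. mul (pro_Im_inf V A \<sigma>) y x = e" if x: "x \<in> ?I" for x
    proof -
      have xI: "x n \<in> Img n" and fx: "n \<le> m \<Longrightarrow> f n m (x m) = x n" for n m
        using x by (simp_all add: pro_Im_inf_carrier)
      obtain y where y: "\<And>n. y n \<in> Img n" "\<And>n. ?M n (x n) (y n) = e n"
        "\<And>n. ?M n (y n) (x n) = e n"
        using inv[OF xI] by metis
      \<comment> \<open>Here \<open>f n m (y m)\<close> is a left inverse and \<open>y n\<close> a
        right inverse of \<open>x n\<close>, so they agree.\<close>
      have fy: "f n m (y m) = y n" if nm: "n \<le> m" for n m
      proof -
        have ym: "f n m (y m) \<in> Img n" using f_Img[OF nm y(1)] .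
        have "?M n (f n m (y m)) (x n) = e n"
          using fm[OF nm y(1) xI] y(3)[of m] fx[OF nm] eI nm by (simp add: pro_Im_inf_carrier)
        then have "?M n (e n) (y n) = ?M n (f n m (y m)) (?M n (x n) (y n))"
          using as[OF ym xI y(1)] by simp
        then show ?thesis using e(2)[OF y(1)] e(3)[OF ym] y(2) by simp
      qed
      then have "y \<in> ?I" using y(1) by (simp add: pro_Im_inf_carrier)
      moreover have "mul (pro_Im_inf V A \<sigma>) y x = e" using y(3) by (simp add: pro_Im_inf_mul)
      ultimately show ?thesis by blast
    qed
  qed (use mulI eI in auto)
  then show ?thesis unfolding is_group_def by blast
qed

end

theorem theorem7p11:
  fixes A :: "nat \<Rightarrow> 'a set"
    and \<sigma> :: "nat \<Rightarrow> 'a list \<Rightarrow> 'a list"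
    and V :: "nat sgrp set"
  assumes "directive_seq A \<sigma>"
    and "primitive_seq A \<sigma>"
    and "pseudovariety V"
    and "LSl \<subseteq> V"
  shows "(has_proper_contraction A \<sigma> \<longleftrightarrow>
            (\<forall>k. is_group (pro_Im V (seq_shift k A) (seq_shift k \<sigma>))))
       \<and> ((\<forall>k. is_group (pro_Im V (seq_shift k A) (seq_shift k \<sigma>))) \<longleftrightarrow>
            is_group (pro_Im_inf V A \<sigma>))"
proof -
  interpret pro_directive A \<sigma> V
    by unfold_locales (rule assms)+
  have "has_proper_contraction A \<sigma> \<longleftrightarrow> (\<forall>k. is_group (PI k))"
    unfolding has_proper_contraction_iff
    using PI_group[OF assms(2)] group_imp_proper_image[OF assms(4)] by blast
  moreover have "(\<forall>k. is_group (PI k)) \<longleftrightarrow> is_group (pro_Im_inf V A \<sigma>)"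
    using PI_group_of_inf inf_group_of_PI by blast
  ultimately show ?thesis unfolding pro_Im_shift by blast
qed

end
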